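(* Let $f=(f_1,f_2,\dots)\in\ell_1$ with $\|f\|_{\ell_1}=1$ and let $W_f=\ker f\subset c$. Consider the following properties: (1) $W_f$ is $1$-complemented in $c$; (2) $W_f$ is isometric to $c$; (3) there exists $j_0\geq 2$ such that $|f_{j_0}|\geq\frac12$; (4) $W_f^*$ is isometric to $\ell_1$; (5) there exists $j_0\geq 1$ such that $|f_{j_0}|\geq\frac12$; (6) $W_f$ is isometric to $c_0$; (7) $\inf_P\|P\|=2$, where the infimum is over all bounded linear projections $P$ of $c$ onto $W_f$; (8) $|f_1|=1$ and $f_j=0$ for every $j\geq 2$. Then the following implications hold: $$(1)\Leftrightarrow(2)\Leftrightarrow(3)\Rightarrow(4)\Leftrightarrow(5)\Leftarrow(6)\Leftrightarrow(7)\Leftrightarrow(8).$$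
   Context: All spaces are real. $c$ is the Banach space of convergent sequences $x=(x_1,x_2,\dots)$ with the supremum norm, and $c_0\subset c$ is the subspace of sequences converging to $0$. For $x\in c$ put $x_0=\lim_{i\to\infty}x_i$. An element $f=(f_1,f_2,\dots)\in\ell_1$ acts on $c$ by the duality $f(x)=\sum_{i=0}^{\infty}f_{i+1}x_i$ (so $f_1$ multiplies the limit $x_0$); this identifies $\ell_1$ with $c^*$. $W_f=\{x\in c: f(x)=0\}$. "Isometric" means isometrically isomorphic (linearly). A subspace is $1$-complemented in $c$ if it is the range of a linear projection of norm $1$ on $c$. *)

theory Defs
  imports "HOL-Analysis.Analysis" "HOL-Library.Function_Algebras"
begin

section \<open>Function spaces as real vector spaces\<close>

text \<open>Pointwise scalar multiplication; addition is already pointwise.  Sequence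
  spaces and dual spaces are subspaces of function types.\<close>

instantiation "fun" :: (type, real_vector) real_vector
begin

definition scaleR_fun :: "real \<Rightarrow> ('a \<Rightarrow> 'b) \<Rightarrow> 'a \<Rightarrow> 'b" where
  "scaleR_fun r f = (\<lambda>x. r *\<^sub>R f x)"

instance
  by standard
    (auto simp: scaleR_fun_def fun_eq_iff scaleR_add_right scaleR_add_left)

end

lemma scaleR_fun_apply [simp]: "(r *\<^sub>R f) x = r *\<^sub>R f x"
  by (simp add: scaleR_fun_def)

section \<open>The Banach space c\<close>

typedef convseq = "{x :: nat \<Rightarrow> real. convergent x}"
  morphisms seq_of Convseq
  by (rule exI[of _ "\<lambda>_. 0"]) (simp add: convergent_const)

setup_lifting type_definition_convseq

lemma convergent_seq_of: "convergent (seq_of x)"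
  using seq_of[of x] by simp

lemma bdd_above_seq_of: "bdd_above (range (\<lambda>n. \<bar>seq_of x n\<bar>))"
proof -
  have "Bseq (seq_of x)"
    by (rule convergent_imp_Bseq[OF convergent_seq_of])
  then obtain K where "\<And>n. norm (seq_of x n) \<le> K"
    using BseqE by blast
  then show ?thesis
    by (intro bdd_aboveI2) simp
qed

instantiation convseq :: real_vector
begin

lift_definition zero_convseq :: convseq is "\<lambda>_. 0"
  by (rule convergent_const)

lift_definition plus_convseq :: "convseq \<Rightarrow> convseq \<Rightarrow> convseq" is "\<lambda>x y n. x n + y n"
  by (rule convergent_add)

lift_definition uminus_convseq :: "convseq \<Rightarrow> convseq" is "\<lambda>x n. - x n"
  by (simp add: convergent_minus_iff[symmetric])

lift_definition minus_convseq :: "convseq \<Rightarrow> convseq \<Rightarrow> convseq" is "\<lambda>x y n. x n - y n"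
  by (rule convergent_diff)

lift_definition scaleR_convseq :: "real \<Rightarrow> convseq \<Rightarrow> convseq" is "\<lambda>r x n. r * x n"
  by (rule convergent_mult[OF convergent_const])

instance
  by standard (transfer, simp add: fun_eq_iff algebra_simps)+

end

instantiation convseq :: real_normed_vector
begin

definition norm_convseq :: "convseq \<Rightarrow> real" where
  "norm_convseq x = (SUP n. \<bar>seq_of x n\<bar>)"

definition dist_convseq :: "convseq \<Rightarrow> convseq \<Rightarrow> real" where
  "dist_convseq x y = norm (x - y)"

definition sgn_convseq :: "convseq \<Rightarrow> convseq" where
  "sgn_convseq x = x /\<^sub>R norm x"

definition uniformity_convseq :: "(convseq \<times> convseq) filter" where
  "uniformity_convseq = (INF e\<in>{0 <..}. principal {(x, y). dist x y < e})"

definition open_convseq :: "convseq set \<Rightarrow> bool" where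
  "open_convseq U = (\<forall>x\<in>U. eventually (\<lambda>(x', y). x' = x \<longrightarrow> y \<in> U) uniformity)"

instance
proof
  fix x y :: convseq and r :: real
  have upper: "\<bar>seq_of z n\<bar> \<le> norm z" for z n
    unfolding norm_convseq_def by (rule cSUP_upper[OF _ bdd_above_seq_of]) simp
  have least: "norm z \<le> K" if "\<And>n. \<bar>seq_of z n\<bar> \<le> K" for z K
    unfolding norm_convseq_def by (rule cSUP_least) (use that in auto)
  have scale_le: "norm (s *\<^sub>R z) \<le> \<bar>s\<bar> * norm z" for s and z :: convseq
    by (rule least) (simp add: scaleR_convseq.rep_eq abs_mult mult_left_mono upper)
  have norm0: "norm (0::convseq) = 0"
    by (simp add: norm_convseq_def zero_convseq.rep_eq)
  show "dist x y = norm (x - y)"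
    by (rule dist_convseq_def)
  show "sgn x = x /\<^sub>R norm x"
    by (rule sgn_convseq_def)
  show "uniformity = (INF e\<in>{0 <..}. principal {(x :: convseq, y). dist x y < e})"
    by (rule uniformity_convseq_def)
  show "open U = (\<forall>x\<in>U. eventually (\<lambda>(x', y). x' = x \<longrightarrow> y \<in> U) uniformity)"
    for U :: "convseq set"
    by (rule open_convseq_def)
  show "(norm x = 0) = (x = 0)"
  proof
    assume "norm x = 0"
    then have "seq_of x n = 0" for n
      using upper[of x n] by simp
    then show "x = 0"
      by transfer auto
  qed (simp add: norm0)
  show "norm (x + y) \<le> norm x + norm y"
  proof (rule least)
    fix n
    have "\<bar>seq_of (x + y) n\<bar> \<le> \<bar>seq_of x n\<bar> + \<bar>seq_of y n\<bar>"
      by (simp add: plus_convseq.rep_eq)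
    also have "\<dots> \<le> norm x + norm y"
      by (intro add_mono upper)
    finally show "\<bar>seq_of (x + y) n\<bar> \<le> norm x + norm y" .
  qed
  show "norm (r *\<^sub>R x) = \<bar>r\<bar> * norm x"
  proof (cases "r = 0")
    case True
    then show ?thesis by (simp add: norm0)
  next
    case False
    have "norm x = norm (inverse r *\<^sub>R (r *\<^sub>R x))"
      using False by simp
    also have "\<dots> \<le> \<bar>inverse r\<bar> * norm (r *\<^sub>R x)"
      by (rule scale_le)
    finally have "\<bar>r\<bar> * norm x \<le> norm (r *\<^sub>R x)"
      using False by (simp add: field_simps)
    with scale_le[of r x] show ?thesis by simp
  qed
qed

end

definition c0 :: "convseq set" where
  "c0 = {x. seq_of x \<longlonglongrightarrow> 0}"

section \<open>The space l1 and its action on c\<close>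

text \<open>Sequences are functions on \<^typ>\<open>nat\<close>, hence numbered from 0: the entry
  \<open>f\<^sub>j\<close> (with \<open>j \<ge> 1\<close>) of \<open>f = (f\<^sub>1, f\<^sub>2, \<dots>)\<close> is \<open>f (j - 1)\<close>.\<close>

definition ell1 :: "(nat \<Rightarrow> real) set" where
  "ell1 = {f. summable (\<lambda>n. \<bar>f n\<bar>)}"

definition ell1_norm :: "(nat \<Rightarrow> real) \<Rightarrow> real" where
  "ell1_norm f = (\<Sum>n. \<bar>f n\<bar>)"

text \<open>\<open>coord x i\<close> is \<open>x\<^sub>i\<close> in the convention where \<open>x = (x\<^sub>1, x\<^sub>2, \<dots>)\<close> and
  \<open>x\<^sub>0\<close> denotes the limit of \<open>x\<close>.\<close>

definition coord :: "convseq \<Rightarrow> nat \<Rightarrow> real" where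
  "coord x i = (case i of 0 \<Rightarrow> lim (seq_of x) | Suc n \<Rightarrow> seq_of x n)"

text \<open>\<open>f(x) = \<Sum>\<^sub>i f\<^sub>i\<^sub>+\<^sub>1 x\<^sub>i\<close>; the index shift disappears because \<open>f i\<close> is \<open>f\<^sub>i\<^sub>+\<^sub>1\<close>.\<close>

definition pairing :: "(nat \<Rightarrow> real) \<Rightarrow> convseq \<Rightarrow> real" where
  "pairing f x = (\<Sum>i. f i * coord x i)"

definition W :: "(nat \<Rightarrow> real) \<Rightarrow> convseq set" where
  "W f = {x. pairing f x = 0}"

section \<open>Isometries, duals and projections\<close>

text \<open>A normed space is given by a carrier \<open>V\<close>, a linear subspace of an ambient
  real vector space, together with a norm \<open>nV\<close> on \<open>V\<close>.\<close>

definition isometric ::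
  "'a::real_vector set \<Rightarrow> ('a \<Rightarrow> real) \<Rightarrow> 'b::real_vector set \<Rightarrow> ('b \<Rightarrow> real) \<Rightarrow> bool" where
  "isometric V nV U nU \<longleftrightarrow>
     (\<exists>T. bij_betw T V U \<and>
          (\<forall>x\<in>V. \<forall>y\<in>V. T (x + y) = T x + T y) \<and>
          (\<forall>r. \<forall>x\<in>V. T (r *\<^sub>R x) = r *\<^sub>R T x) \<and>
          (\<forall>x\<in>V. nU (T x) = nV x))"

text \<open>The bounded linear functionals on a subspace \<open>V\<close>.  Being total functions on
  the ambient type, they are made to vanish outside \<open>V\<close>, so that each functional on
  \<open>V\<close> has exactly one representative.\<close>

definition dual :: "'a::real_normed_vector set \<Rightarrow> ('a \<Rightarrow> real) set" where
  "dual V = {\<phi>. (\<forall>x\<in>V. \<forall>y\<in>V. \<phi> (x + y) = \<phi> x + \<phi> y) \<and>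
                (\<forall>r. \<forall>x\<in>V. \<phi> (r *\<^sub>R x) = r * \<phi> x) \<and>
                (\<exists>K. \<forall>x\<in>V. \<bar>\<phi> x\<bar> \<le> K * norm x) \<and>
                (\<forall>x. x \<notin> V \<longrightarrow> \<phi> x = 0)}"

definition dual_norm :: "'a::real_normed_vector set \<Rightarrow> ('a \<Rightarrow> real) \<Rightarrow> real" where
  "dual_norm V \<phi> = (SUP x\<in>{x\<in>V. norm x \<le> 1}. \<bar>\<phi> x\<bar>)"

definition projection_onto ::
  "('a::real_normed_vector \<Rightarrow> 'a) \<Rightarrow> 'a set \<Rightarrow> bool" where
  "projection_onto P V \<longleftrightarrow> bounded_linear P \<and> P \<circ> P = P \<and> range P = V"

definition one_complemented :: "'a::real_normed_vector set \<Rightarrow> bool" where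
  "one_complemented V \<longleftrightarrow> (\<exists>P. projection_onto P V \<and> onorm P = 1)"

text \<open>The infimum is that of the reals, so it is meaningful only if some bounded
  projection onto \<open>V\<close> exists; this is the case for kernels of bounded functionals.\<close>

definition projection_constant :: "'a::real_normed_vector set \<Rightarrow> real" where
  "projection_constant V = Inf {onorm P | P. projection_onto P V}"

end

(* Think of c as C(K) with K = {0, 1, 2, ...} converging to 0 (coord x 0 is the limit), so that
   f is a summable weight on K.

   If |f j| >= 1/2 for some j >= 1, the j-th coordinate of an element of the kernel is a weighted
   average of the others with total weight at most 1, so it can be forgotten isometrically.
   An isometry T defined on c or c0 must reproduce every coordinate up to sign:
   coord (T x) (k m) = s m * x_m for some k m in K, which is injective in m and hence tends to
   the limit point 0. From c onto W f this yields the norm-one projection y |-> T (s m * y_(k m));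
   from c0 it shows that all limits in W f vanish. Projections onto W f have the form
   x |-> x - f(x) z with f(z) = 1, and their k-th coordinate functional has l1 norm
   |1 - z_k f_k| + |z_k| (1 - |f_k|). Finally, the dual of W f is l1 modulo the line of f. *)

theory Submission
  imports Defs
begin

section \<open>Coordinates, spikes and the pairing\<close>

text \<open>Index 0 is the one non-isolated point of K. Vectors are pushed into \<open>W f\<close>
  by adding a multiple of a spike at \<open>j\<close>, and spikes exist only for j >= 1; hence the
  restriction on \<open>j\<close> for c and its absence for the dual, where only the weights on K
  remain and 0 is an index like any other. The hard converse is the one for the dual, since nothing
  is known about the isometry onto l1. Composed with the quotient map it becomes a contraction of l1
  onto l1 that kills exactly the line of f and through which every element lifts without increase of
  norm. Hahn-Banach supplies these lifts, so norms are attained and the extremality of the unit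
  vectors can be used without any epsilon. For the projection constant, a strict bound needs one
  projection whose coordinate functionals all stay away from 2. If |z_k| = 1 and f_k is small, the
  value 2 is nearly reached; therefore z is damped everywhere except at one coordinate with nonzero
  weight, which absorbs the difference.\<close>

lemma seq_of_eq_coord: "seq_of x n = coord x (Suc n)"
  by (simp add: coord_def)

lemma coord_tendsto: "(\<lambda>n. coord x n) \<longlonglongrightarrow> coord x 0"
proof -
  have "(\<lambda>n. coord x (Suc n)) \<longlonglongrightarrow> coord x 0"
    using convergent_seq_of[of x] by (simp add: coord_def convergent_LIMSEQ_iff)
  then show ?thesis by (rule LIMSEQ_imp_Suc)
qed

lemma coord_eqI:
  assumes "\<And>i. coord x (Suc i) = coord y (Suc i)"
  shows "x = y"
proof -
  have "seq_of x = seq_of y" using assms by (auto simp: seq_of_eq_coord)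
  then show ?thesis by (simp add: seq_of_inject)
qed

lemma coord_0I: "(\<lambda>n. coord x (Suc n)) \<longlonglongrightarrow> l \<Longrightarrow> coord x 0 = l"
  using LIMSEQ_unique LIMSEQ_Suc[OF coord_tendsto] by blast

lemma coord_add [simp]: "coord (x + y) i = coord x i + coord y i"
proof (cases i)
  case 0
  show ?thesis unfolding 0
    by (rule coord_0I) (auto simp: seq_of_eq_coord[symmetric] plus_convseq.rep_eq
        intro!: tendsto_add LIMSEQ_Suc[OF coord_tendsto, of x, folded seq_of_eq_coord]
          LIMSEQ_Suc[OF coord_tendsto, of y, folded seq_of_eq_coord])
qed (simp add: seq_of_eq_coord[symmetric] plus_convseq.rep_eq)

lemma coord_scaleR [simp]: "coord (r *\<^sub>R x) i = r * coord x i"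
proof (cases i)
  case 0
  show ?thesis unfolding 0
    by (rule coord_0I) (auto simp: seq_of_eq_coord[symmetric] scaleR_convseq.rep_eq
        intro!: tendsto_mult_left LIMSEQ_Suc[OF coord_tendsto, of x, folded seq_of_eq_coord])
qed (simp add: seq_of_eq_coord[symmetric] scaleR_convseq.rep_eq)

lemma coord_minus [simp]: "coord (- x) i = - coord x i"
  using coord_scaleR[of "-1" x i] by simp

lemma coord_diff [simp]: "coord (x - y) i = coord x i - coord y i"
  using coord_add[of x "- y" i] by simp

lemma coord_zero [simp]: "coord 0 i = 0"
  using coord_scaleR[of 0 0 i] by simp

lemma coord_sum [simp]: "coord (\<Sum>a\<in>S. g a) i = (\<Sum>a\<in>S. coord (g a) i)"
  by (induction S rule: infinite_finite_induct) auto

lemma norm_convseq_le: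
  assumes "\<And>n. \<bar>coord x (Suc n)\<bar> \<le> K"
  shows "norm x \<le> K"
  unfolding norm_convseq_def by (rule cSUP_least) (use assms in \<open>auto simp: seq_of_eq_coord\<close>)

lemma abs_coord_le: "\<bar>coord x i\<bar> \<le> norm x"
proof -
  have *: "\<bar>coord x (Suc n)\<bar> \<le> norm x" for n
    unfolding norm_convseq_def seq_of_eq_coord[symmetric]
    by (rule cSUP_upper[OF _ bdd_above_seq_of]) simp
  show ?thesis
  proof (cases i)
    case 0
    have "(\<lambda>n. \<bar>coord x (Suc n)\<bar>) \<longlonglongrightarrow> \<bar>coord x 0\<bar>"
      by (intro tendsto_rabs LIMSEQ_Suc coord_tendsto)
    then show ?thesis
      unfolding 0 by (rule LIMSEQ_le_const2) (use * in auto)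
  qed (simp add: *)
qed

lemma norm_convseq_attained: "\<exists>k. \<bar>coord x k\<bar> = norm x"
proof (rule ccontr)
  assume "\<not> ?thesis"
  then have less: "\<bar>coord x k\<bar> < norm x" for k
    using abs_coord_le[of x k] by (meson order_le_less)
  define c where "c = (\<bar>coord x 0\<bar> + norm x) / 2"
  have c: "\<bar>coord x 0\<bar> < c" "c < norm x" using less[of 0] by (auto simp: c_def)
  have "(\<lambda>n. \<bar>coord x n\<bar>) \<longlonglongrightarrow> \<bar>coord x 0\<bar>"
    by (intro tendsto_rabs coord_tendsto)
  then have "eventually (\<lambda>n. \<bar>coord x n\<bar> < c) sequentially"
    using c(1) by (rule order_tendstoD)
  then obtain N where N: "\<And>n. n \<ge> N \<Longrightarrow> \<bar>coord x n\<bar> < c"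
    by (auto simp: eventually_sequentially)
  define M where "M = Max (insert c ((\<lambda>k. \<bar>coord x k\<bar>) ` {..<N}))"
  have "M < norm x" using less c by (auto simp: M_def)
  moreover have "norm x \<le> M"
  proof (rule norm_convseq_le)
    fix n
    show "\<bar>coord x (Suc n)\<bar> \<le> M"
    proof (cases "Suc n < N")
      case False
      then have "\<bar>coord x (Suc n)\<bar> \<le> c" using N[of "Suc n"] by simp
      also have "c \<le> M" by (simp add: M_def)
      finally show ?thesis .
    qed (simp add: M_def)
  qed
  ultimately show False by simp
qed

text \<open>\<open>X 0\<close> does not enter the construction. It only records the intended limit,
  so it is recovered as a coordinate exactly when \<open>X\<close> tends to it.\<close>

definition of_coords :: "(nat \<Rightarrow> real) \<Rightarrow> convseq" where
  "of_coords X = Convseq (\<lambda>n. X (Suc n))"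

lemma coord_of_coords:
  assumes "X \<longlonglongrightarrow> X 0"
  shows "coord (of_coords X) i = X i"
proof -
  have lim: "(\<lambda>n. X (Suc n)) \<longlonglongrightarrow> X 0"
    using assms by (rule LIMSEQ_Suc)
  then have "seq_of (of_coords X) = (\<lambda>n. X (Suc n))"
    unfolding of_coords_def by (intro Convseq_inverse) (auto intro: convergentI)
  then have *: "coord (of_coords X) (Suc n) = X (Suc n)" for n
    by (simp add: seq_of_eq_coord[symmetric])
  have "coord (of_coords X) 0 = X 0"
    by (rule coord_0I) (simp add: * lim)
  with * show ?thesis by (cases i) auto
qed

lemma coord_of_coords_const:
  assumes "\<And>n. n \<ge> N \<Longrightarrow> X n = X 0"
  shows "coord (of_coords X) i = X i"
  by (rule coord_of_coords, rule tendsto_eventually)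
    (use assms in \<open>auto simp: eventually_sequentially\<close>)

text \<open>Meaningful for j >= 1 only: the indicator of the limit point 0 is not continuous on
  K.\<close>

definition spike :: "nat \<Rightarrow> convseq" where
  "spike j = of_coords (indicator {j})"

lemma coord_spike [simp]: "j \<ge> 1 \<Longrightarrow> coord (spike j) i = indicator {j} i"
  unfolding spike_def by (rule coord_of_coords_const[of "Suc j"]) auto

lemma norm_spike [simp]:
  assumes "j \<ge> 1"
  shows "norm (spike j) = 1"
proof (rule antisym)
  show "norm (spike j) \<le> 1"
    by (rule norm_convseq_le) (use assms in \<open>auto simp: indicator_def\<close>)
  show "1 \<le> norm (spike j)"
    using abs_coord_le[of "spike j" j] assms by simp
qed

definition const_one :: convseq where
  "const_one = of_coords (\<lambda>_. 1)"

lemma coord_const_one [simp]: "coord const_one i = 1"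
  unfolding const_one_def by (rule coord_of_coords) simp

lemma norm_const_one [simp]: "norm const_one = 1"
  by (rule antisym[OF norm_convseq_le]) (use abs_coord_le[of const_one 0] in auto)

section \<open>The norm of l1\<close>

lemma ell1_iff: "f \<in> ell1 \<longleftrightarrow> summable (\<lambda>n. \<bar>f n\<bar>)"
  by (simp add: ell1_def)

lemma ell1_add [intro]: "f \<in> ell1 \<Longrightarrow> g \<in> ell1 \<Longrightarrow> f + g \<in> ell1"
  unfolding ell1_iff plus_fun_def
  by (rule summable_comparison_test'[OF summable_add[of "\<lambda>n. \<bar>f n\<bar>" "\<lambda>n. \<bar>g n\<bar>"]])
    (auto intro: abs_triangle_ineq)

lemma ell1_scaleR [intro]: "f \<in> ell1 \<Longrightarrow> r *\<^sub>R f \<in> ell1"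
  unfolding ell1_iff by (simp add: abs_mult)

lemma ell1_diff [intro]: "f \<in> ell1 \<Longrightarrow> g \<in> ell1 \<Longrightarrow> f - g \<in> ell1"
  using ell1_add[of f "(-1) *\<^sub>R g"] ell1_scaleR[of g "-1"] by simp

lemma ell1_indicator [intro]: "indicator {j} \<in> ell1"
  unfolding ell1_iff by (rule summable_finite[of "{j}"]) auto

lemma ell1_norm_indicator [simp]: "ell1_norm (indicator {j}) = 1"
  unfolding ell1_norm_def by (subst suminf_finite[of "{j}"]) auto

lemma ell1_norm_nonneg: "f \<in> ell1 \<Longrightarrow> 0 \<le> ell1_norm f"
  unfolding ell1_iff ell1_norm_def by (simp add: suminf_nonneg)

lemma ell1_norm_scaleR: "f \<in> ell1 \<Longrightarrow> ell1_norm (r *\<^sub>R f) = \<bar>r\<bar> * ell1_norm f"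
  unfolding ell1_iff ell1_norm_def by (simp add: abs_mult suminf_mult)

lemma ell1_norm_triangle:
  assumes "f \<in> ell1" "g \<in> ell1"
  shows "ell1_norm (f + g) \<le> ell1_norm f + ell1_norm g"
proof -
  have "ell1_norm (f + g) \<le> (\<Sum>n. \<bar>f n\<bar> + \<bar>g n\<bar>)"
    unfolding ell1_norm_def
    using assms ell1_add[OF assms] by (intro suminf_le summable_add) (auto simp: ell1_iff)
  then show ?thesis
    using assms by (simp add: ell1_norm_def ell1_iff suminf_add)
qed

lemma ell1_norm_remove:
  assumes "f \<in> ell1"
  shows "f(j := 0) \<in> ell1" and "ell1_norm f = \<bar>f j\<bar> + ell1_norm (f(j := 0))"
proof -
  have eq: "(\<lambda>n. \<bar>(f(j := 0)) n\<bar>) = (\<lambda>n. \<bar>f n\<bar> - (if n = j then \<bar>f n\<bar> else 0))"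
    by auto
  have s: "(\<lambda>n. if n = j then \<bar>f n\<bar> else 0) sums \<bar>f j\<bar>"
    by (rule sums_single)
  have "(\<lambda>n. \<bar>(f(j := 0)) n\<bar>) sums (ell1_norm f - \<bar>f j\<bar>)"
    unfolding eq ell1_norm_def
    by (rule sums_diff[OF _ s]) (use assms in \<open>simp add: ell1_iff summable_sums\<close>)
  then show "f(j := 0) \<in> ell1" "ell1_norm f = \<bar>f j\<bar> + ell1_norm (f(j := 0))"
    by (auto simp: ell1_iff ell1_norm_def sums_iff)
qed

lemma abs_le_ell1_norm: "f \<in> ell1 \<Longrightarrow> \<bar>f j\<bar> \<le> ell1_norm f"
  using ell1_norm_remove[of f j] ell1_norm_nonneg[of "f(j := 0)"] by simp

lemma ell1_norm_eq_0: "f \<in> ell1 \<Longrightarrow> ell1_norm f \<le> 0 \<Longrightarrow> f = 0"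
proof (rule ext)
  show "f j = 0 j" if "f \<in> ell1" "ell1_norm f \<le> 0" for j
    using abs_le_ell1_norm[OF that(1), of j] that(2) by simp
qed

lemma ell1_subspace: "subspace ell1"
  by (rule subspaceI) (auto simp: ell1_iff[of 0])

lemma ell1_norm_eq_0_iff: "f \<in> ell1 \<Longrightarrow> ell1_norm f = 0 \<longleftrightarrow> f = 0"
  using ell1_norm_eq_0[of f] by (auto simp: ell1_norm_def)

section \<open>The pairing of l1 with c\<close>

lemma pairing_summable:
  assumes "f \<in> ell1"
  shows "summable (\<lambda>i. \<bar>f i * coord x i\<bar>)"
  by (rule summable_comparison_test'[of "\<lambda>i. \<bar>f i\<bar> * norm x" 0])
    (use assms in \<open>auto simp: ell1_iff abs_mult summable_mult2 intro!: mult_left_mono abs_coord_le\<close>)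

lemma pairing_sums: "f \<in> ell1 \<Longrightarrow> (\<lambda>i. f i * coord x i) sums pairing f x"
  unfolding pairing_def using pairing_summable[of f x]
  by (simp add: summable_rabs_cancel summable_sums)

lemma abs_pairing_le:
  assumes "f \<in> ell1"
  shows "\<bar>pairing f x\<bar> \<le> ell1_norm f * norm x"
proof -
  have "\<bar>pairing f x\<bar> \<le> (\<Sum>i. \<bar>f i * coord x i\<bar>)"
    unfolding pairing_def by (rule summable_rabs[OF pairing_summable[OF assms]])
  also have "\<dots> \<le> (\<Sum>i. \<bar>f i\<bar> * norm x)"
    using assms by (intro suminf_le pairing_summable)
      (auto simp: ell1_iff abs_mult summable_mult2 intro!: mult_left_mono abs_coord_le)
  also have "\<dots> = ell1_norm f * norm x"
    using assms by (simp add: ell1_iff ell1_norm_def suminf_mult2)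
  finally show ?thesis .
qed

lemma pairing_add: "f \<in> ell1 \<Longrightarrow> pairing f (x + y) = pairing f x + pairing f y"
  using sums_add[OF pairing_sums pairing_sums, of f f x y] pairing_sums[of f "x + y"]
  by (auto simp: algebra_simps intro: sums_unique2)

lemma pairing_scaleR: "f \<in> ell1 \<Longrightarrow> pairing f (r *\<^sub>R x) = r * pairing f x"
  using sums_mult[OF pairing_sums, of f r x] pairing_sums[of f "r *\<^sub>R x"]
  by (auto simp: algebra_simps intro: sums_unique2)

lemma pairing_linear: "f \<in> ell1 \<Longrightarrow> linear (pairing f)"
  by (rule linearI) (auto simp: pairing_add pairing_scaleR)

lemma pairing_bounded_linear: "f \<in> ell1 \<Longrightarrow> bounded_linear (pairing f)"
  by (rule bounded_linear_intro[of _ "ell1_norm f"])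
    (auto simp: pairing_add pairing_scaleR mult.commute[of "norm _"] abs_pairing_le)

lemma pairing_add_left: "f \<in> ell1 \<Longrightarrow> g \<in> ell1 \<Longrightarrow> pairing (f + g) x = pairing f x + pairing g x"
  using sums_add[OF pairing_sums pairing_sums, of f g x x] pairing_sums[of "f + g" x]
  by (auto simp: algebra_simps intro: sums_unique2)

lemma pairing_scaleR_left: "f \<in> ell1 \<Longrightarrow> pairing (r *\<^sub>R f) x = r * pairing f x"
  using sums_mult[OF pairing_sums, of f r x] pairing_sums[of "r *\<^sub>R f" x]
  by (auto simp: algebra_simps intro: sums_unique2)

lemma pairing_diff_left:
  "f \<in> ell1 \<Longrightarrow> g \<in> ell1 \<Longrightarrow> pairing (f - g) x = pairing f x - pairing g x"
  using pairing_add_left[of f "(-1) *\<^sub>R g" x] pairing_scaleR_left[of g "-1" x] ell1_scaleR[of g "-1"]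
  by simp

lemma pairing_indicator [simp]: "pairing (indicator {j}) x = coord x j"
  unfolding pairing_def by (subst suminf_finite[of "{j}"]) auto

lemma pairing_spike [simp]: "j \<ge> 1 \<Longrightarrow> pairing f (spike j) = f j"
  unfolding pairing_def by (subst suminf_finite[of "{j}"]) auto

lemma pairing_remove:
  assumes "f \<in> ell1"
  shows "pairing f x = f j * coord x j + pairing (f(j := 0)) x"
proof -
  have "f(j := 0) = f - f j *\<^sub>R indicator {j}"
    by (auto simp: fun_eq_iff indicator_def)
  then show ?thesis
    using assms by (simp add: pairing_diff_left pairing_scaleR_left ell1_scaleR ell1_indicator)
qed

text \<open>The signs of \<open>f\<close> would norm it exactly but need not converge. They are kept
  up to an index with small remaining mass and replaced by the sign of \<open>f 0\<close>, the
  weight of the limit, from there on; this costs at most twice the tail.\<close>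

lemma pairing_almost_norming:
  assumes f: "f \<in> ell1" and "e > 0"
  obtains x where "norm x \<le> 1" "pairing f x \<ge> ell1_norm f - e"
proof -
  obtain N where N: "\<And>n. n \<ge> N \<Longrightarrow> norm (\<Sum>i. \<bar>f (i + n)\<bar>) < e / 2"
    using suminf_exist_split[of "e / 2" "\<lambda>n. \<bar>f n\<bar>"] assms by (auto simp: ell1_iff)
  define M where "M = Suc N"
  define X where "X = (\<lambda>k. if k < M then sgn (f k) else sgn (f 0))"
  define x where "x = of_coords X"
  have coord: "coord x k = X k" for k
    unfolding x_def by (rule coord_of_coords_const[of M]) (auto simp: X_def M_def)
  let ?d = "\<lambda>k. \<bar>f k\<bar> - f k * X k"
  have d: "?d sums (ell1_norm f - pairing f x)"
    unfolding coord[symmetric] ell1_norm_def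
    by (intro sums_diff pairing_sums f summable_sums) (use f in \<open>simp add: ell1_iff\<close>)
  have "ell1_norm f - pairing f x = (\<Sum>k. ?d (k + M)) + (\<Sum>k<M. ?d k)"
    using suminf_split_initial_segment[of ?d M] d by (simp add: sums_iff)
  also have "(\<Sum>k<M. ?d k) = 0"
    by (rule sum.neutral) (auto simp: X_def abs_sgn)
  also have "(\<Sum>k. ?d (k + M)) \<le> (\<Sum>k. 2 * \<bar>f (k + M)\<bar>)"
  proof (rule suminf_le)
    show "?d (k + M) \<le> 2 * \<bar>f (k + M)\<bar>" for k
      by (auto simp: X_def sgn_if)
    show "summable (\<lambda>k. ?d (k + M))"
      using d by (intro summable_ignore_initial_segment) (auto simp: sums_iff)
    show "summable (\<lambda>k. 2 * \<bar>f (k + M)\<bar>)"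
      using f by (intro summable_mult) (subst summable_iff_shift, simp add: ell1_iff)
  qed
  also have "\<dots> = 2 * (\<Sum>k. \<bar>f (k + M)\<bar>)"
    using f by (intro suminf_mult, subst summable_iff_shift) (simp add: ell1_iff)
  also have "\<dots> \<le> e"
    using N[of M] by (simp add: M_def)
  finally have "pairing f x \<ge> ell1_norm f - e" by simp
  moreover have "norm x \<le> 1"
    by (rule norm_convseq_le) (simp add: coord X_def sgn_if)
  ultimately show thesis using that by blast
qed

text \<open>The embedding of l1 into the dual of c is isometric; this turns operator bounds into
  bounds on l1 norms.\<close>

lemma ell1_norm_le:
  assumes f: "f \<in> ell1" and le: "\<And>x. \<bar>pairing f x\<bar> \<le> K * norm x"
  shows "ell1_norm f \<le> K"
proof (rule field_le_epsilon)
  fix e :: real assume "e > 0"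
  then obtain x where x: "norm x \<le> 1" "pairing f x \<ge> ell1_norm f - e"
    using pairing_almost_norming[OF f] by blast
  have "0 \<le> K" using le[of "spike 1"] by simp
  have "pairing f x \<le> K * norm x" using le[of x] by simp
  also have "\<dots> \<le> K" using x(1) \<open>0 \<le> K\<close> by (simp add: mult_left_le)
  finally show "ell1_norm f \<le> K + e" using x by simp
qed

lemma W_subspace: "f \<in> ell1 \<Longrightarrow> subspace (W f)"
  unfolding W_def by (rule subspaceI)
    (auto simp: pairing_add pairing_scaleR linear_0[OF pairing_linear])

lemma pairing_eq_oneE:
  assumes "f \<in> ell1" "ell1_norm f = 1"
  obtains w where "pairing f w = 1"
proof -
  obtain x where x: "pairing f x \<noteq> 0"
    using pairing_almost_norming[OF assms(1), of "1/2"] assms(2) by force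
  have "pairing f ((1 / pairing f x) *\<^sub>R x) = 1"
    using x assms(1) by (simp add: pairing_scaleR)
  then show thesis using that by blast
qed

section \<open>Functionals\<close>

lemma coord_sum_spikes:
  "coord (\<Sum>n<N. a n *\<^sub>R spike (Suc n)) (Suc i) = (if i < N then a i else 0)"
proof -
  have "coord (\<Sum>n<N. a n *\<^sub>R spike (Suc n)) (Suc i) = (\<Sum>n<N. if n = i then a n else 0)"
    by (auto simp: indicator_def intro!: sum.cong)
  then show ?thesis by simp
qed

text \<open>The identification of the dual of c with l1. Spikes span only the null sequences
  densely, so the values on spikes give the weights from index 1 on and the value on
  \<open>const_one\<close> supplies the weight of the limit.\<close>

lemma ell1_representation:
  fixes \<psi> :: "convseq \<Rightarrow> real"
  assumes lin: "linear \<psi>" and bound: "\<And>x. \<bar>\<psi> x\<bar> \<le> K * norm x"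
  obtains h where "h \<in> ell1" "ell1_norm h \<le> K" "\<psi> = pairing h"
proof -
  have K: "0 \<le> K" using bound[of "spike 1"] by simp
  define b where "b = (\<lambda>n. \<psi> (spike (Suc n)))"
  have "(\<Sum>n<N. \<bar>b n\<bar>) \<le> K" for N
  proof -
    \<comment> \<open>A vector of norm at most 1 on which the functional collects the absolute
      values of the first N weights.\<close>
    define x where "x = (\<Sum>n<N. sgn (b n) *\<^sub>R spike (Suc n))"
    have "coord x (Suc i) = (if i < N then sgn (b i) else 0)" for i
      unfolding x_def by (rule coord_sum_spikes)
    then have "norm x \<le> 1"
      by (intro norm_convseq_le) (simp add: sgn_if)
    have "(\<Sum>n<N. \<bar>b n\<bar>) = \<psi> x"
      unfolding x_def linear_sum[OF lin] linear_scale[OF lin]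
      by (simp add: b_def abs_sgn mult.commute)
    also have "\<dots> \<le> K * norm x" using bound[of x] by simp
    also have "\<dots> \<le> K" using K \<open>norm x \<le> 1\<close> by (simp add: mult_left_le)
    finally show ?thesis .
  qed
  then have sb: "summable (\<lambda>n. \<bar>b n\<bar>)"
    by (intro summableI_nonneg_bounded) auto
  \<comment> \<open>A constant sequence pairs to the sum of all weights, which determines the one at
    0.\<close>
  define h where "h = (\<lambda>k. case k of 0 \<Rightarrow> \<psi> const_one - (\<Sum>n. b n) | Suc n \<Rightarrow> b n)"
  have h: "h \<in> ell1"
    unfolding ell1_iff by (subst summable_Suc_iff[symmetric]) (simp add: h_def sb)
  have rep: "\<psi> x = pairing h x" for x
  proof -
    define l where "l = coord x 0"
    \<comment> \<open>Once its limit is subtracted, \<open>x\<close> is the norm limit of finite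
      combinations of spikes; \<open>z N\<close> is the remainder.\<close>
    define z where "z = (\<lambda>N. x - l *\<^sub>R const_one - (\<Sum>n<N. (coord x (Suc n) - l) *\<^sub>R spike (Suc n)))"
    have coord_z: "coord (z N) (Suc i) = (if i < N then 0 else coord x (Suc i) - l)" for N i
      using coord_sum_spikes[of "\<lambda>n. coord x (Suc n) - l" N i]
      by (simp add: z_def del: coord_sum)
    have z0: "z \<longlonglongrightarrow> 0"
    proof (rule LIMSEQ_I)
      fix r :: real assume "r > 0"
      then obtain M where M: "\<And>n. n \<ge> M \<Longrightarrow> \<bar>coord x n - l\<bar> < r / 2"
        using LIMSEQ_D[OF coord_tendsto[of x], of "r / 2"] by (auto simp: l_def)
      have "norm (z N - 0) < r" if "N \<ge> M" for N
      proof -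
        have "norm (z N) \<le> r / 2"
        proof (rule norm_convseq_le)
          show "\<bar>coord (z N) (Suc n)\<bar> \<le> r / 2" for n
            using M[of "Suc n"] that \<open>r > 0\<close> by (auto simp: coord_z)
        qed
        then show ?thesis using \<open>r > 0\<close> by simp
      qed
      then show "\<exists>no. \<forall>n\<ge>no. norm (z n - 0) < r" by blast
    qed
    have "bounded_linear \<psi>"
      by (rule bounded_linear_intro[of _ K])
        (use bound in \<open>simp_all add: linear_add[OF lin] linear_scale[OF lin] mult.commute[of "norm _"]\<close>)
    then have "(\<lambda>N. \<psi> (z N)) \<longlonglongrightarrow> \<psi> 0"
      using z0 by (rule bounded_linear.tendsto)
    moreover have "\<psi> (z N) = \<psi> x - l * \<psi> const_one - (\<Sum>n<N. (coord x (Suc n) - l) * b n)" for N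
      unfolding z_def by (simp add: linear_diff[OF lin] linear_scale[OF lin] linear_sum[OF lin] b_def)
    ultimately have "(\<lambda>N. \<psi> x - l * \<psi> const_one - (\<Sum>n<N. (coord x (Suc n) - l) * b n)) \<longlonglongrightarrow> 0"
      by (simp add: linear_0[OF lin])
    from tendsto_diff[OF tendsto_const[of "\<psi> x - l * \<psi> const_one"] this]
    have "(\<lambda>n. (coord x (Suc n) - l) * b n) sums (\<psi> x - l * \<psi> const_one)"
      by (simp add: sums_def)
    moreover have "(\<lambda>n. l * b n) sums (l * (\<Sum>n. b n))"
      by (intro sums_mult summable_sums summable_rabs_cancel[OF sb])
    ultimately have "(\<lambda>n. (coord x (Suc n) - l) * b n + l * b n) sums
        (\<psi> x - l * \<psi> const_one + l * (\<Sum>n. b n))"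
      by (rule sums_add)
    then have "(\<lambda>n. b n * coord x (Suc n)) sums (\<psi> x - l * \<psi> const_one + l * (\<Sum>n. b n))"
      by (simp add: algebra_simps)
    moreover have "(\<lambda>n. h (Suc n) * coord x (Suc n)) sums (pairing h x - h 0 * coord x 0)"
      using pairing_sums[OF h, of x] by (subst sums_Suc_iff) simp
    ultimately have "\<psi> x - l * \<psi> const_one + l * (\<Sum>n. b n) = pairing h x - h 0 * coord x 0"
      by (simp add: h_def sums_iff)
    then show ?thesis by (simp add: h_def l_def algebra_simps)
  qed
  have "ell1_norm h \<le> K"
    by (rule ell1_norm_le[OF h]) (use bound in \<open>simp add: rep[symmetric]\<close>)
  with h rep show thesis using that by blast
qed

text \<open>The one-dimensional step of the Hahn--Banach theorem suffices, as \<open>W f\<close> is a hyperplane.\<close>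

lemma hyperplane_extension:
  fixes p \<phi> :: "'a::real_normed_vector \<Rightarrow> real"
  assumes p: "linear p" and w: "p w = 1"
    and add: "\<And>x y. p x = 0 \<Longrightarrow> p y = 0 \<Longrightarrow> \<phi> (x + y) = \<phi> x + \<phi> y"
    and scale: "\<And>r x. p x = 0 \<Longrightarrow> \<phi> (r *\<^sub>R x) = r * \<phi> x"
    and bound: "\<And>x. p x = 0 \<Longrightarrow> \<bar>\<phi> x\<bar> \<le> K * norm x" and "0 \<le> K"
  obtains \<psi> where "linear \<psi>" "\<And>x. \<bar>\<psi> x\<bar> \<le> K * norm x" "\<And>x. p x = 0 \<Longrightarrow> \<psi> x = \<phi> x"
proof -
  note p_simps = linear_add[OF p] linear_diff[OF p] linear_scale[OF p] linear_0[OF p] w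
  let ?L = "\<lambda>y. - (K * norm (y + w)) - \<phi> y"
  have sep: "?L y \<le> K * norm (y' + w) - \<phi> y'" if "p y = 0" "p y' = 0" for y y'
  proof -
    have "\<phi> y' - \<phi> y = \<phi> (y' - y)"
      using add[of "y' - y" y] that by (simp add: p_simps)
    also have "\<dots> \<le> K * norm (y' - y)"
      using bound[of "y' - y"] that by (simp add: p_simps)
    also have "\<dots> \<le> K * (norm (y' + w) + norm (y + w))"
      using norm_triangle_ineq4[of "y' + w" "y + w"] \<open>0 \<le> K\<close> by (intro mult_left_mono) auto
    finally show ?thesis by (simp add: algebra_simps)
  qed
  \<comment> \<open>Any number between the lower bounds \<open>?L\<close> and the upper bounds in
    \<open>sep\<close> can serve as the value of the extension at \<open>w\<close>; the left end of
    this interval is taken.\<close>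
  define a where "a = (SUP y\<in>{y. p y = 0}. ?L y)"
  have p0: "{y. p y = 0} \<noteq> {}" using p_simps(4) by blast
  have bdd: "bdd_above (?L ` {y. p y = 0})"
    by (rule bdd_aboveI2) (use sep[of _ 0] p_simps(4) in auto)
  have upper: "?L y \<le> a" if "p y = 0" for y
    unfolding a_def by (rule cSUP_upper[OF _ bdd]) (use that in simp)
  have lower: "a \<le> K * norm (y + w) - \<phi> y" if "p y = 0" for y
    unfolding a_def by (rule cSUP_least[OF p0]) (use sep that in simp)
  have norm_a: "\<bar>\<phi> y + a\<bar> \<le> K * norm (y + w)" if "p y = 0" for y
    using upper[OF that] lower[OF that] by (simp add: abs_le_iff)
  define \<psi> where "\<psi> = (\<lambda>x. \<phi> (x - p x *\<^sub>R w) + p x * a)"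
  have "linear \<psi>"
  proof (rule linearI)
    fix x y :: 'a and r :: real
    have "x + y - p (x + y) *\<^sub>R w = (x - p x *\<^sub>R w) + (y - p y *\<^sub>R w)"
      by (simp add: p_simps algebra_simps)
    moreover have "\<phi> ((x - p x *\<^sub>R w) + (y - p y *\<^sub>R w)) = \<phi> (x - p x *\<^sub>R w) + \<phi> (y - p y *\<^sub>R w)"
      by (rule add) (simp_all add: p_simps)
    ultimately show "\<psi> (x + y) = \<psi> x + \<psi> y"
      unfolding \<psi>_def by (simp only: p_simps distrib_right)
    have "r *\<^sub>R x - p (r *\<^sub>R x) *\<^sub>R w = r *\<^sub>R (x - p x *\<^sub>R w)"
      by (simp add: p_simps algebra_simps)
    moreover have "\<phi> (r *\<^sub>R (x - p x *\<^sub>R w)) = r * \<phi> (x - p x *\<^sub>R w)"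
      by (rule scale) (simp add: p_simps)
    ultimately show "\<psi> (r *\<^sub>R x) = r *\<^sub>R \<psi> x"
      unfolding \<psi>_def by (simp add: p_simps distrib_left)
  qed
  moreover have "\<bar>\<psi> x\<bar> \<le> K * norm x" for x
  proof (cases "p x = 0")
    case True
    then show ?thesis by (simp add: \<psi>_def bound)
  next
    case False
    \<comment> \<open>By homogeneity it is enough to have the bound where p equals 1, and there
      every point has the form y + w.\<close>
    define y where "y = (1 / p x) *\<^sub>R (x - p x *\<^sub>R w)"
    have y: "p y = 0" by (simp add: y_def p_simps)
    have x: "x = p x *\<^sub>R (y + w)" using False by (simp add: y_def algebra_simps)
    have "x - p x *\<^sub>R w = p x *\<^sub>R y" using False by (simp add: y_def)
    then have "\<psi> x = p x * (\<phi> y + a)"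
      by (simp add: \<psi>_def scale[OF y] distrib_left)
    then have "\<bar>\<psi> x\<bar> \<le> \<bar>p x\<bar> * (K * norm (y + w))"
      using norm_a[OF y] by (simp add: abs_mult mult_left_mono)
    also have "\<dots> = K * norm x"
      using arg_cong[OF x, of norm] by simp
    finally show ?thesis .
  qed
  moreover have "\<psi> x = \<phi> x" if "p x = 0" for x
    using that by (simp add: \<psi>_def)
  ultimately show thesis using that by blast
qed

section \<open>The dual norm and the quotient map from l1 onto the dual of the hyperplane\<close>

lemma dual_norm_le:
  assumes "subspace V" "\<And>x. x \<in> V \<Longrightarrow> norm x \<le> 1 \<Longrightarrow> \<bar>\<phi> x\<bar> \<le> K"
  shows "dual_norm V \<phi> \<le> K"
  unfolding dual_norm_def
  by (rule cSUP_least) (use assms subspace_0[OF assms(1)] in \<open>auto intro: exI[of _ 0]\<close>)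

lemma dual_norm_upper:
  assumes \<phi>: "\<phi> \<in> dual V" and x: "x \<in> V" "norm x \<le> 1"
  shows "\<bar>\<phi> x\<bar> \<le> dual_norm V \<phi>"
proof -
  obtain K where K: "\<And>x. x \<in> V \<Longrightarrow> \<bar>\<phi> x\<bar> \<le> K * norm x"
    using \<phi> unfolding dual_def by blast
  have bdd: "bdd_above ((\<lambda>x. \<bar>\<phi> x\<bar>) ` {x \<in> V. norm x \<le> 1})"
  proof (rule bdd_aboveI2)
    fix x assume x: "x \<in> {x \<in> V. norm x \<le> 1}"
    then have "\<bar>\<phi> x\<bar> \<le> K * norm x" using K by simp
    also have "\<dots> \<le> \<bar>K\<bar> * 1" using x by (intro mult_mono) auto
    finally show "\<bar>\<phi> x\<bar> \<le> \<bar>K\<bar>" by simp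
  qed
  show ?thesis
    unfolding dual_norm_def by (rule cSUP_upper[OF _ bdd]) (use x in simp)
qed

lemma dual_norm_nonneg:
  assumes "subspace V" "\<phi> \<in> dual V"
  shows "0 \<le> dual_norm V \<phi>"
  using dual_norm_upper[OF assms(2) subspace_0[OF assms(1)]] by simp

lemma abs_le_dual_norm:
  assumes V: "subspace V" and \<phi>: "\<phi> \<in> dual V" and x: "x \<in> V"
  shows "\<bar>\<phi> x\<bar> \<le> dual_norm V \<phi> * norm x"
proof (cases "x = 0")
  case True
  have "\<phi> (0 *\<^sub>R x) = 0 * \<phi> x"
    using \<phi> x unfolding dual_def by blast
  then show ?thesis using True by simp
next
  case False
  define u where "u = (1 / norm x) *\<^sub>R x"
  have u: "u \<in> V" "norm u \<le> 1" using False x V by (auto simp: u_def subspace_scale)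
  have "\<phi> u = (1 / norm x) * \<phi> x"
    using \<phi> x unfolding dual_def u_def by blast
  then have "\<bar>\<phi> x\<bar> = \<bar>\<phi> u\<bar> * norm x" using False by (simp add: abs_mult)
  also have "\<dots> \<le> dual_norm V \<phi> * norm x"
    by (intro mult_right_mono dual_norm_upper[OF \<phi> u]) simp
  finally show ?thesis .
qed

text \<open>The quotient map from l1 to the dual of \<open>W f\<close>; the value 0 off
  \<open>W f\<close> selects the representative that \<open>dual\<close> prescribes.\<close>

definition restriction :: "(nat \<Rightarrow> real) \<Rightarrow> (nat \<Rightarrow> real) \<Rightarrow> convseq \<Rightarrow> real" where
  "restriction f g x = (if x \<in> W f then pairing g x else 0)"

lemma restriction_dual:
  assumes f: "f \<in> ell1" and g: "g \<in> ell1"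
  shows "restriction f g \<in> dual (W f)"
  unfolding dual_def
  using subspace_add[OF W_subspace[OF f]] subspace_scale[OF W_subspace[OF f]]
  by (auto simp: restriction_def pairing_add[OF g] pairing_scaleR[OF g]
      intro!: exI[of _ "ell1_norm g"] abs_pairing_le[OF g])

lemma dual_norm_restriction_le:
  assumes f: "f \<in> ell1" and g: "g \<in> ell1"
  shows "dual_norm (W f) (restriction f g) \<le> ell1_norm g"
proof (rule dual_norm_le[OF W_subspace[OF f]])
  fix x assume x: "x \<in> W f" "norm x \<le> 1"
  have "\<bar>restriction f g x\<bar> \<le> ell1_norm g * norm x"
    using x abs_pairing_le[OF g] by (simp add: restriction_def)
  also have "\<dots> \<le> ell1_norm g"
    using x ell1_norm_nonneg[OF g] by (simp add: mult_left_le)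
  finally show "\<bar>restriction f g x\<bar> \<le> ell1_norm g" .
qed

lemma restriction_add:
  "g \<in> ell1 \<Longrightarrow> h \<in> ell1 \<Longrightarrow> restriction f (g + h) = restriction f g + restriction f h"
  by (simp add: fun_eq_iff restriction_def pairing_add_left)

lemma restriction_scaleR: "g \<in> ell1 \<Longrightarrow> restriction f (r *\<^sub>R g) = r *\<^sub>R restriction f g"
  by (simp add: fun_eq_iff restriction_def pairing_scaleR_left)

context
  fixes f :: "nat \<Rightarrow> real"
  assumes f: "f \<in> ell1" and f1: "ell1_norm f = 1"
begin

text \<open>Hahn-Banach followed by the representation of functionals on c. The quotient norm is
  thus attained, not merely approximated.\<close>

lemma dual_lift:
  assumes \<phi>: "\<phi> \<in> dual (W f)"
  obtains h where "h \<in> ell1" "ell1_norm h \<le> dual_norm (W f) \<phi>" "\<phi> = restriction f h"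
proof -
  obtain w where w: "pairing f w = 1" using pairing_eq_oneE[OF f f1] .
  have Wf: "x \<in> W f \<longleftrightarrow> pairing f x = 0" for x by (simp add: W_def)
  have bound: "\<bar>\<phi> x\<bar> \<le> dual_norm (W f) \<phi> * norm x" if "pairing f x = 0" for x
    using abs_le_dual_norm[OF W_subspace[OF f] \<phi>] that by (simp add: Wf)
  have "0 \<le> dual_norm (W f) \<phi>"
    by (rule dual_norm_nonneg[OF W_subspace[OF f] \<phi>])
  then obtain \<psi> where \<psi>: "linear \<psi>" "\<And>x. \<bar>\<psi> x\<bar> \<le> dual_norm (W f) \<phi> * norm x"
      "\<And>x. pairing f x = 0 \<Longrightarrow> \<psi> x = \<phi> x"
    using hyperplane_extension[OF pairing_linear[OF f] w, of \<phi> "dual_norm (W f) \<phi>"] \<phi> bound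
    by (auto simp: dual_def Wf)
  obtain h where h: "h \<in> ell1" "ell1_norm h \<le> dual_norm (W f) \<phi>" "\<psi> = pairing h"
    using ell1_representation[OF \<psi>(1,2)] .
  have "\<phi> = restriction f h"
    using \<phi> \<psi>(3) by (auto simp: fun_eq_iff restriction_def h(3) Wf dual_def)
  with h show thesis using that by blast
qed

text \<open>If \<open>pairing f w = 1\<close>, then c is \<open>W f\<close> plus the line of
  \<open>w\<close>. With t the value of \<open>g\<close> at \<open>w\<close>, the functional of g -
  t f vanishes on both.\<close>

lemma restriction_eq_0_imp:
  assumes g: "g \<in> ell1" and 0: "restriction f g = 0"
  obtains t where "g = t *\<^sub>R f"
proof -
  obtain w where w: "pairing f w = 1" using pairing_eq_oneE[OF f f1] .
  define t where "t = pairing g w"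
  have d: "g - t *\<^sub>R f \<in> ell1" using f g by blast
  have "pairing (g - t *\<^sub>R f) x = 0" for x
  proof -
    have "x - pairing f x *\<^sub>R w \<in> W f"
      by (simp add: W_def linear_diff[OF pairing_linear[OF f]] pairing_scaleR[OF f] w)
    then have "pairing g (x - pairing f x *\<^sub>R w) = 0"
      using fun_cong[OF 0, of "x - pairing f x *\<^sub>R w"] by (simp add: restriction_def)
    then show ?thesis
      using f g by (simp add: pairing_diff_left pairing_scaleR_left ell1_scaleR t_def
          linear_diff[OF pairing_linear[OF g]] pairing_scaleR mult.commute)
  qed
  then have "g - t *\<^sub>R f = 0"
    by (intro ell1_norm_eq_0[OF d] ell1_norm_le[OF d]) simp
  then show thesis using that[of t] by (metis eq_iff_diff_eq_0)
qed

end

section \<open>Projections onto hyperplanes\<close>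

lemma onorm_projection_ge_1:
  assumes P: "projection_onto P V" and "y \<in> V" "y \<noteq> 0"
  shows "1 \<le> onorm P"
proof -
  have bl: "bounded_linear P" and "P \<circ> P = P" "range P = V"
    using P by (auto simp: projection_onto_def)
  then have "P y = y" using \<open>y \<in> V\<close> by (metis comp_apply rangeE)
  then have "norm y \<le> onorm P * norm y" using onorm[OF bl, of y] by simp
  then show ?thesis using \<open>y \<noteq> 0\<close> by simp
qed

text \<open>A nonzero fixed vector excludes norms below 1, so that a contraction has norm exactly
  1.\<close>

lemma one_complementedI:
  assumes P: "projection_onto P V" and le: "\<And>x. norm (P x) \<le> norm x"
    and y: "y \<in> V" "y \<noteq> 0"
  shows "one_complemented V"
proof -
  have "onorm P \<le> 1" by (rule onorm_bound) (simp_all add: le)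
  then have "onorm P = 1" using onorm_projection_ge_1[OF P y] by simp
  then show ?thesis using P by (auto simp: one_complemented_def)
qed

lemma projection_constant_le:
  assumes "projection_onto P V" "onorm P \<le> K"
  shows "projection_constant V \<le> K"
proof -
  have "projection_constant V \<le> onorm P"
    unfolding projection_constant_def
  proof (rule cInf_lower)
    show "onorm P \<in> {onorm P |P. projection_onto P V}" using assms by blast
    show "bdd_below {onorm P |P. projection_onto P V}"
      by (rule bdd_belowI[of _ 0]) (auto simp: projection_onto_def onorm_pos_le)
  qed
  then show ?thesis using assms by simp
qed

lemma hyperplane_projection:
  assumes f: "f \<in> ell1" and z: "pairing f z = 1"
  shows "projection_onto (\<lambda>x. x - pairing f x *\<^sub>R z) (W f)"
  unfolding projection_onto_def
proof (intro conjI)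
  show "bounded_linear (\<lambda>x. x - pairing f x *\<^sub>R z)"
    by (intro bounded_linear_sub bounded_linear_ident bounded_linear_scaleR_const
        pairing_bounded_linear f)
  have in_W: "x - pairing f x *\<^sub>R z \<in> W f" for x
    by (simp add: W_def linear_diff[OF pairing_linear[OF f]] pairing_scaleR[OF f] z)
  then show "(\<lambda>x. x - pairing f x *\<^sub>R z) \<circ> (\<lambda>x. x - pairing f x *\<^sub>R z) = (\<lambda>x. x - pairing f x *\<^sub>R z)"
    by (auto simp: fun_eq_iff W_def)
  have "x \<in> range (\<lambda>x. x - pairing f x *\<^sub>R z)" if "x \<in> W f" for x
    using that by (intro range_eqI[of _ _ x]) (simp add: W_def)
  with in_W show "range (\<lambda>x. x - pairing f x *\<^sub>R z) = W f" by auto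
qed

context
  fixes f :: "nat \<Rightarrow> real"
  assumes f: "f \<in> ell1" and f1: "ell1_norm f = 1"
begin

text \<open>Pick \<open>w\<close> with \<open>pairing f w = 1\<close>. The projection fixes x - f(x)
  w, and z = w - P w results from linearity.\<close>

lemma projection_onto_hyperplaneE:
  assumes P: "projection_onto P (W f)"
  obtains z where "pairing f z = 1" "\<And>x. P x = x - pairing f x *\<^sub>R z"
proof -
  have lin: "linear P" and PP: "P \<circ> P = P" and range: "range P = W f"
    using P by (auto simp: projection_onto_def bounded_linear.linear)
  have fix_W: "P y = y" if "y \<in> W f" for y
    using that PP range by (metis comp_apply rangeE)
  obtain w where w: "pairing f w = 1" using pairing_eq_oneE[OF f f1] .
  have PW: "pairing f (P x) = 0" for x
    using range by (auto simp: W_def)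
  show thesis
  proof
    show "pairing f (w - P w) = 1"
      by (simp add: linear_diff[OF pairing_linear[OF f]] w PW)
    fix x
    have "P (x - pairing f x *\<^sub>R w) = x - pairing f x *\<^sub>R w"
      by (rule fix_W) (simp add: W_def linear_diff[OF pairing_linear[OF f]] pairing_scaleR[OF f] w)
    then show "P x = x - pairing f x *\<^sub>R (w - P w)"
      by (simp add: linear_diff[OF lin] linear_scale[OF lin] algebra_simps)
  qed
qed

lemma ell1_norm_indicator_diff:
  "ell1_norm (indicator {k} - c *\<^sub>R f) = \<bar>1 - c * f k\<bar> + \<bar>c\<bar> * (1 - \<bar>f k\<bar>)"
proof -
  define g where "g = indicator {k} - c *\<^sub>R f"
  have g: "g \<in> ell1" unfolding g_def using f by blast
  \<comment> \<open>Off \<open>k\<close> only the multiple of \<open>f\<close> is left, of mass |c|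
    (1 - |f k|).\<close>
  have "g(k := 0) = (- c) *\<^sub>R (f(k := 0))"
    by (auto simp: g_def fun_eq_iff)
  then have "ell1_norm g = \<bar>1 - c * f k\<bar> + \<bar>c\<bar> * ell1_norm (f(k := 0))"
    using ell1_norm_remove(2)[OF g, of k] ell1_norm_scaleR[OF ell1_norm_remove(1)[OF f, of k], of "- c"]
    by (simp add: g_def)
  then show ?thesis using ell1_norm_remove(2)[OF f, of k] f1 by (simp add: g_def)
qed

lemma onorm_hyperplane_projection_ge:
  assumes P: "bounded_linear P" "\<And>x. P x = x - pairing f x *\<^sub>R z"
  shows "\<bar>1 - coord z k * f k\<bar> + \<bar>coord z k\<bar> * (1 - \<bar>f k\<bar>) \<le> onorm P"
  unfolding ell1_norm_indicator_diff[symmetric]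
proof (rule ell1_norm_le)
  show "indicator {k} - coord z k *\<^sub>R f \<in> ell1" using f by blast
  fix x
  have "pairing (indicator {k} - coord z k *\<^sub>R f) x = coord (P x) k"
    using f by (simp add: pairing_diff_left pairing_scaleR_left ell1_scaleR ell1_indicator P(2))
  also have "\<bar>\<dots>\<bar> \<le> norm (P x)" by (rule abs_coord_le)
  also have "\<dots> \<le> onorm P * norm x" by (rule onorm[OF P(1)])
  finally show "\<bar>pairing (indicator {k} - coord z k *\<^sub>R f) x\<bar> \<le> onorm P * norm x" .
qed

text \<open>The norm of the k-th coordinate functional is at least 1 + |z_k| (1 - 2 |f k|). If all
  weights from index 1 on are below 1/2, norm 1 forces z_k = 0 for all k >= 1, hence z = 0, against
  f(z) = 1.\<close>

lemma one_complemented_imp_large_coeff: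
  assumes "one_complemented (W f)"
  shows "\<exists>j\<ge>1. 1 / 2 \<le> \<bar>f j\<bar>"
proof (rule ccontr)
  assume "\<not> ?thesis"
  then have small: "\<bar>f j\<bar> < 1 / 2" if "j \<ge> 1" for j using that by force
  obtain P where P: "projection_onto P (W f)" "onorm P = 1"
    using assms by (auto simp: one_complemented_def)
  obtain z where z: "pairing f z = 1" "\<And>x. P x = x - pairing f x *\<^sub>R z"
    using projection_onto_hyperplaneE[OF P(1)] by blast
  have "coord z k = 0" if "k \<ge> 1" for k
  proof -
    let ?c = "coord z k"
    have "\<bar>1 - ?c * f k\<bar> + \<bar>?c\<bar> * (1 - \<bar>f k\<bar>) \<le> 1"
      using onorm_hyperplane_projection_ge[OF _ z(2), of k] P by (auto simp: projection_onto_def)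
    then have "\<bar>?c\<bar> * (1 - 2 * \<bar>f k\<bar>) \<le> 0"
      using abs_ge_self[of "?c * f k"] by (simp add: abs_mult algebra_simps)
    then show ?thesis using small[OF that] by (simp add: mult_le_0_iff)
  qed
  then have "z = 0" by (intro coord_eqI) simp
  then show False using z(1) by (simp add: linear_0[OF pairing_linear[OF f]])
qed

lemma hyperplane_coord_le:
  assumes j: "j \<ge> 1" "1 / 2 \<le> \<bar>f j\<bar>" and x: "x \<in> W f"
    and K: "\<And>i. i \<noteq> j \<Longrightarrow> \<bar>coord x i\<bar> \<le> K"
  shows "\<bar>coord x j\<bar> \<le> K"
proof -
  \<comment> \<open>Erasing the coordinate \<open>j\<close> leaves the pairing with the remaining
    weights unchanged and makes \<open>K\<close> a bound on the whole norm.\<close>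
  define y where "y = x - coord x j *\<^sub>R spike j"
  have "0 \<le> K" using K[of "Suc j"] by simp
  have y: "norm y \<le> K"
    by (rule norm_convseq_le) (use K \<open>0 \<le> K\<close> j in \<open>auto simp: y_def indicator_def\<close>)
  have r: "f(j := 0) \<in> ell1" "ell1_norm (f(j := 0)) = 1 - \<bar>f j\<bar>"
    using ell1_norm_remove[OF f, of j] f1 by auto
  have "pairing (f(j := 0)) y = pairing (f(j := 0)) x"
    using j by (simp add: y_def linear_diff[OF pairing_linear[OF r(1)]] pairing_scaleR[OF r(1)])
  also have "\<dots> = - (f j * coord x j)"
    using pairing_remove[OF f, of x j] x by (simp add: W_def)
  finally have "\<bar>f j\<bar> * \<bar>coord x j\<bar> = \<bar>pairing (f(j := 0)) y\<bar>" by (simp add: abs_mult)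
  also have "\<dots> \<le> (1 - \<bar>f j\<bar>) * norm y"
    using abs_pairing_le[OF r(1)] by (simp add: r(2))
  also have "\<dots> \<le> \<bar>f j\<bar> * K"
    using y j abs_le_ell1_norm[OF f, of j] f1 \<open>0 \<le> K\<close> by (intro mult_mono) auto
  finally show ?thesis using j by (simp add: mult_le_cancel_left)
qed

lemma large_coeff_imp_one_complemented:
  assumes j: "j \<ge> 1" "1 / 2 \<le> \<bar>f j\<bar>"
  shows "one_complemented (W f)"
proof -
  have fj: "f j \<noteq> 0" using j by auto
  \<comment> \<open>With \<open>z\<close> supported at \<open>j\<close>, the projection alters the
    coordinate \<open>j\<close> only, and its new value is controlled by the others because the
    image lies in \<open>W f\<close>.\<close>
  define z where "z = (1 / f j) *\<^sub>R spike j"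
  have z: "pairing f z = 1" using fj j by (simp add: z_def pairing_scaleR[OF f])
  define P where "P = (\<lambda>x. x - pairing f x *\<^sub>R z)"
  have P: "projection_onto P (W f)" unfolding P_def by (rule hyperplane_projection[OF f z])
  have coord_P: "coord (P x) i = coord x i" if "i \<noteq> j" for x i
    using that j by (simp add: P_def z_def)
  have PW: "P x \<in> W f" for x using P by (auto simp: projection_onto_def)
  show ?thesis
  proof (rule one_complementedI[OF P])
    show "norm (P x) \<le> norm x" for x
    proof (rule norm_convseq_le)
      have *: "\<bar>coord (P x) i\<bar> \<le> norm x" if "i \<noteq> j" for i
        using abs_coord_le coord_P that by simp
      show "\<bar>coord (P x) (Suc i)\<bar> \<le> norm x" for i
        by (cases "Suc i = j") (use * hyperplane_coord_le[OF j PW, of x "norm x"] in auto)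
    qed
    show "P (spike (Suc j)) \<in> W f" by (rule PW)
    have "coord (P (spike (Suc j))) (Suc j) = 1"
      by (subst coord_P) auto
    then show "P (spike (Suc j)) \<noteq> 0" by auto
  qed
qed

end

section \<open>Linear isometries and the deletion of one coordinate\<close>

lemma isometricI:
  assumes V: "subspace V"
    and add: "\<And>x y. x \<in> V \<Longrightarrow> y \<in> V \<Longrightarrow> T (x + y) = T x + T y"
    and scale: "\<And>r x. x \<in> V \<Longrightarrow> T (r *\<^sub>R x) = r *\<^sub>R T x"
    and norm: "\<And>x. x \<in> V \<Longrightarrow> nU (T x) = nV x"
    and norm_0: "\<And>x. x \<in> V \<Longrightarrow> nV x = 0 \<longleftrightarrow> x = 0"
    and image: "T ` V = U"
  shows "isometric V nV U nU"
proof -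
  have "inj_on T V"
  proof (rule inj_onI)
    fix x y assume xy: "x \<in> V" "y \<in> V" "T x = T y"
    have V': "0 \<in> V" "(-1) *\<^sub>R y \<in> V" "x + (-1) *\<^sub>R y \<in> V"
      using V xy by (auto intro!: subspace_0 subspace_add subspace_scale subspace_neg subspace_diff)
    have "T (x + (-1) *\<^sub>R y) = T 0"
      using add[OF xy(1) V'(2)] scale[OF xy(2), of "-1"] scale[OF V'(1), of 0] xy(3) by simp
    then have "nV (x + (-1) *\<^sub>R y) = nV 0"
      using norm V' by metis
    then have "x + (-1) *\<^sub>R y = 0"
      using norm_0 V' by metis
    then show "x = y" by simp
  qed
  then have "bij_betw T V U" using image by (simp add: bij_betw_def)
  with add scale norm show ?thesis unfolding isometric_def by blast
qed

lemma isometric_sym: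
  assumes iso: "isometric V nV U nU" and V: "subspace V"
  shows "isometric U nU V nV"
proof -
  obtain T where T: "bij_betw T V U" "\<And>x y. x \<in> V \<Longrightarrow> y \<in> V \<Longrightarrow> T (x + y) = T x + T y"
    "\<And>r x. x \<in> V \<Longrightarrow> T (r *\<^sub>R x) = r *\<^sub>R T x" "\<And>x. x \<in> V \<Longrightarrow> nU (T x) = nV x"
    using iso unfolding isometric_def by blast
  let ?S = "the_inv_into V T"
  have inj: "inj_on T V" using T(1) by (simp add: bij_betw_def)
  have S: "?S y \<in> V" "T (?S y) = y" if "y \<in> U" for y
    using that T(1) by (auto simp: bij_betw_def the_inv_into_into f_the_inv_into_f)
  have ST: "?S (T x) = x" if "x \<in> V" for x
    using inj that by (rule the_inv_into_f_f)
  have "bij_betw ?S U V" using T(1) by (rule bij_betw_the_inv_into)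
  moreover have "?S (x + y) = ?S x + ?S y" if "x \<in> U" "y \<in> U" for x y
    using ST[of "?S x + ?S y"] T(2) S that V by (simp add: subspace_add)
  moreover have "?S (r *\<^sub>R x) = r *\<^sub>R ?S x" if "x \<in> U" for r x
    using ST[of "r *\<^sub>R ?S x"] T(3) S that V by (simp add: subspace_scale)
  moreover have "nV (?S x) = nU x" if "x \<in> U" for x
    using T(4)[of "?S x"] S that by simp
  ultimately show ?thesis unfolding isometric_def by blast
qed

text \<open>The increasing enumeration of all indices other than \<open>j\<close>. For j >= 1 it
  fixes 0, so the limit stays the limit.\<close>

definition skip :: "nat \<Rightarrow> nat \<Rightarrow> nat" where
  "skip j i = (if i < j then i else Suc i)"

definition insert_zero :: "nat \<Rightarrow> (nat \<Rightarrow> real) \<Rightarrow> nat \<Rightarrow> real" where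
  "insert_zero j g i = (if i < j then g i else if i = j then 0 else g (i - 1))"

lemma insert_zero_skip [simp]: "insert_zero j g (skip j i) = g i"
  by (simp add: insert_zero_def skip_def)

lemma insert_zero_self [simp]: "insert_zero j g j = 0"
  by (simp add: insert_zero_def)

lemma skip_cases: obtains "i = j" | k where "i = skip j k"
  using that(1) that(2)[of "if i < j then i else i - 1"] by (cases i j rule: linorder_cases) (auto simp: skip_def)

lemma coord_skip_tendsto: "(\<lambda>i. coord x (skip j i)) \<longlonglongrightarrow> coord x 0"
proof (rule LIMSEQ_offset[of _ j])
  show "(\<lambda>n. coord x (skip j (n + j))) \<longlonglongrightarrow> coord x 0"
    using LIMSEQ_ignore_initial_segment[OF coord_tendsto[of x], of "Suc j"] by (simp add: skip_def)
qed

lemma insert_zero_coord_tendsto: "insert_zero j (coord y) \<longlonglongrightarrow> coord y 0"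
proof (rule LIMSEQ_offset[of _ "Suc j"])
  show "(\<lambda>n. insert_zero j (coord y) (n + Suc j)) \<longlonglongrightarrow> coord y 0"
    using LIMSEQ_ignore_initial_segment[OF coord_tendsto[of y], of j]
    by (simp add: insert_zero_def)
qed

text \<open>Deleting the coordinate \<open>j\<close> loses no norm on \<open>W f\<close>, since it
  is dominated by the others, and it is onto because the deleted value can be chosen to satisfy the
  equation of the hyperplane.\<close>

lemma large_coeff_imp_isometric_c:
  assumes f: "f \<in> ell1" and f1: "ell1_norm f = 1" and j: "j \<ge> 1" "1 / 2 \<le> \<bar>f j\<bar>"
  shows "isometric (W f) norm (UNIV :: convseq set) norm"
proof -
  define T where "T = (\<lambda>x. of_coords (\<lambda>i. coord x (skip j i)))"
  \<comment> \<open>This is where j >= 1 matters: the limit has to survive the deletion.\<close>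
  have skip0: "skip j 0 = 0" using j by (simp add: skip_def)
  have coord_T: "coord (T x) i = coord x (skip j i)" for x i
    unfolding T_def by (rule coord_of_coords) (simp add: skip0 coord_skip_tendsto)
  show ?thesis
  proof (rule isometricI[OF W_subspace[OF f], of T])
    show "T (x + y) = T x + T y" for x y by (rule coord_eqI) (simp add: coord_T)
    show "T (r *\<^sub>R x) = r *\<^sub>R T x" for r x by (rule coord_eqI) (simp add: coord_T)
    show "norm (T x) = norm x" if x: "x \<in> W f" for x
    proof (rule antisym)
      show "norm (T x) \<le> norm x"
        by (rule norm_convseq_le) (simp add: coord_T abs_coord_le)
      have *: "\<bar>coord x i\<bar> \<le> norm (T x)" if "i \<noteq> j" for i
        using that abs_coord_le[of "T x"] unfolding coord_T by (metis skip_cases)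
      show "norm x \<le> norm (T x)"
      proof (rule norm_convseq_le)
        show "\<bar>coord x (Suc i)\<bar> \<le> norm (T x)" for i
          by (cases "Suc i = j") (use * hyperplane_coord_le[OF f f1 j x] in auto)
      qed
    qed
    show "norm x = 0 \<longleftrightarrow> x = 0" for x :: convseq by simp
    have "y \<in> T ` W f" for y
    proof -
      define x where "x = of_coords (insert_zero j (coord y))"
      have x: "coord x i = insert_zero j (coord y) i" for i
        unfolding x_def
        by (rule coord_of_coords) (use j insert_zero_coord_tendsto in \<open>simp add: insert_zero_def\<close>)
      \<comment> \<open>The correction along \<open>spike j\<close> reaches \<open>W f\<close> and
        is invisible after the deletion.\<close>
      define x' where "x' = x - (pairing f x / f j) *\<^sub>R spike j"
      have fj: "f j \<noteq> 0" using j by auto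
      have "x' \<in> W f"
        using j fj by (simp add: W_def x'_def linear_diff[OF pairing_linear[OF f]] pairing_scaleR[OF f])
      moreover have "skip j i \<noteq> j" for i by (simp add: skip_def)
      then have "T x' = y"
        by (intro coord_eqI) (use j in \<open>simp add: coord_T x'_def x\<close>)
      ultimately show ?thesis by blast
    qed
    then show "T ` W f = UNIV" by blast
  qed
qed

section \<open>Isometric copies of c and c0\<close>

text \<open>Let \<open>k\<close> be an index where the image of the spike attains its norm 1. If
  \<open>v\<close> vanishes at \<open>m\<close>, small multiples of \<open>v\<close> can be added to
  the spike with either sign without leaving the unit ball, so the image of \<open>v\<close> must
  vanish at \<open>k\<close>.\<close>

lemma isometry_coord:
  assumes V: "subspace V" and spike: "spike m \<in> V" "m \<ge> 1"
    and add: "\<And>x y. x \<in> V \<Longrightarrow> y \<in> V \<Longrightarrow> T (x + y) = T x + T y"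
    and scale: "\<And>r x. x \<in> V \<Longrightarrow> T (r *\<^sub>R x) = r *\<^sub>R T x"
    and norm: "\<And>x. x \<in> V \<Longrightarrow> norm (T x :: convseq) = norm x"
  obtains k s where "\<bar>s\<bar> = 1" "\<And>x. x \<in> V \<Longrightarrow> coord (T x) k = s * coord x m"
proof -
  obtain k where k: "\<bar>coord (T (spike m)) k\<bar> = 1"
    using norm_convseq_attained[of "T (spike m)"] norm spike by auto
  define s where "s = coord (T (spike m)) k"
  have "coord (T x) k = s * coord x m" if x: "x \<in> V" for x
  proof -
    define v where "v = x + (- coord x m) *\<^sub>R spike m"
    have v: "v \<in> V" using x spike V by (simp add: v_def subspace_diff subspace_scale)
    have v_m: "coord v m = 0" using spike by (simp add: v_def)
    \<comment> \<open>Scales \<open>v\<close> into the unit ball; the summand 1 covers the case v =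
      0.\<close>
    define c where "c = 1 / (norm v + 1)"
    have c: "c > 0" "c * norm v \<le> 1"
      using norm_ge_zero[of v] by (simp_all add: c_def add_nonneg_pos)
    have bound: "\<bar>s + r * coord (T v) k\<bar> \<le> 1" if r: "\<bar>r\<bar> = c" for r
    proof -
      have "norm (spike m + r *\<^sub>R v) \<le> 1"
      proof (rule norm_convseq_le)
        fix i
        have "\<bar>r * coord v (Suc i)\<bar> \<le> c * norm v"
          using c r by (auto simp: abs_mult intro!: mult_left_mono abs_coord_le)
        then show "\<bar>coord (spike m + r *\<^sub>R v) (Suc i)\<bar> \<le> 1"
          using spike v_m c by (cases "Suc i = m") auto
      qed
      then have "norm (T (spike m + r *\<^sub>R v)) \<le> 1"
        using norm v spike V by (simp add: subspace_add subspace_scale)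
      moreover have "T (spike m + r *\<^sub>R v) = T (spike m) + r *\<^sub>R T v"
        using add scale v spike V by (simp add: subspace_scale)
      ultimately show ?thesis
        using abs_coord_le[of "T (spike m + r *\<^sub>R v)" k] by (simp add: s_def)
    qed
    \<comment> \<open>A number of modulus 1 cannot be moved by both u and -u within [-1, 1] unless u
      = 0.\<close>
    have "c * coord (T v) k = 0"
      using bound[of c] bound[of "- c"] c k by (auto simp: s_def abs_if split: if_splits)
    then have "coord (T v) k = 0" using c by simp
    moreover have "T v = T x + (- coord x m) *\<^sub>R T (spike m)"
      unfolding v_def using add[OF x] scale spike V by (simp add: subspace_scale del: scaleR_minus_left)
    ultimately show ?thesis by (simp add: s_def mult.commute)
  qed
  with k show thesis using that[of s k] by (simp add: s_def)
qed

lemma isometry_coords: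
  assumes V: "subspace V" and spike: "\<And>m. spike (Suc m) \<in> V"
    and T: "\<And>x y. x \<in> V \<Longrightarrow> y \<in> V \<Longrightarrow> T (x + y) = T x + T y"
      "\<And>r x. x \<in> V \<Longrightarrow> T (r *\<^sub>R x) = r *\<^sub>R T x"
      "\<And>x. x \<in> V \<Longrightarrow> norm (T x :: convseq) = norm x"
  obtains k s where "inj k" "\<And>m. \<bar>s m\<bar> = 1"
    "\<And>m x. x \<in> V \<Longrightarrow> coord (T x) (k m) = s m * coord x (Suc m)"
proof -
  have "\<exists>k s. \<bar>s\<bar> = 1 \<and> (\<forall>x\<in>V. coord (T x) k = s * coord x (Suc m))" for m
    by (rule isometry_coord[OF V spike _ T, of m]) auto
  then obtain k s where *: "\<And>m. \<bar>s m\<bar> = 1"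
      "\<And>m x. x \<in> V \<Longrightarrow> coord (T x) (k m) = s m * coord x (Suc m)"
    by metis
  have "inj k"
  proof (rule injI, rule ccontr)
    fix m m' assume "k m = k m'" "m \<noteq> m'"
    then have "s m = 0"
      using *(2)[OF spike[of m], of m] *(2)[OF spike[of m], of m'] by simp
    then show False using *(1)[of m] by simp
  qed
  with * show thesis using that by blast
qed

lemma coord_inj_tendsto:
  assumes "inj k"
  shows "(\<lambda>m. coord y (k m)) \<longlonglongrightarrow> coord y 0"
proof (rule filterlim_compose[OF coord_tendsto])
  show "filterlim k at_top sequentially"
    unfolding filterlim_at_top
  proof
    fix Z
    have "finite (k -` {..<Z})" using assms by (intro finite_vimageI) auto
    then show "eventually (\<lambda>m. Z \<le> k m) sequentially"
      by (simp add: cofinite_eq_sequentially[symmetric] eventually_cofinite vimage_def not_le)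
  qed
qed

lemma isometric_c_imp_one_complemented:
  fixes V :: "convseq set"
  assumes V: "subspace V" and iso: "isometric V norm (UNIV :: convseq set) norm"
  shows "one_complemented V"
proof -
  obtain T where bij: "bij_betw T (UNIV :: convseq set) V"
    and T: "\<And>x y. T (x + y) = T x + T y" "\<And>r x. T (r *\<^sub>R x) = r *\<^sub>R T x" "\<And>x. norm (T x) = norm x"
    using isometric_sym[OF iso V] unfolding isometric_def by auto
  obtain k s where k: "inj k" and s: "\<And>m. \<bar>s m\<bar> = 1"
    and coord_T: "\<And>m x. coord (T x) (k m) = s m * coord x (Suc m)"
    using isometry_coords[OF subspace_UNIV UNIV_I T] by auto
  \<comment> \<open>The signs are the coordinates of \<open>T const_one\<close> along
    \<open>k\<close>, hence they converge. This is what makes \<open>R y\<close> a convergent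
    sequence.\<close>
  define t where "t = coord (T const_one) 0"
  have s_lim: "s \<longlonglongrightarrow> t"
    using coord_inj_tendsto[OF k, of "T const_one"] by (simp add: coord_T t_def)
  define R where "R = (\<lambda>y. of_coords (\<lambda>i. case i of 0 \<Rightarrow> t * coord y 0 | Suc m \<Rightarrow> s m * coord y (k m)))"
  have coord_R: "coord (R y) (Suc m) = s m * coord y (k m)" for y m
  proof -
    have "(\<lambda>i. case i of 0 \<Rightarrow> t * coord y 0 | Suc m \<Rightarrow> s m * coord y (k m)) \<longlonglongrightarrow> t * coord y 0"
      by (rule LIMSEQ_imp_Suc) (simp add: tendsto_mult[OF s_lim coord_inj_tendsto[OF k]])
    then show ?thesis unfolding R_def by (subst coord_of_coords) simp_all
  qed
  have R_add: "R (x + y) = R x + R y" for x y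
    by (rule coord_eqI) (simp add: coord_R algebra_simps)
  have R_scale: "R (r *\<^sub>R x) = r *\<^sub>R R x" for r x
    by (rule coord_eqI) (simp add: coord_R algebra_simps)
  have norm_R: "norm (R y) \<le> norm y" for y
    by (rule norm_convseq_le) (simp add: coord_R abs_mult s abs_coord_le)
  have RT: "R (T x) = x" for x
  proof (rule coord_eqI)
    fix i
    have "s i * s i = 1" using s[of i] by (metis abs_mult_self_eq mult_1)
    then show "coord (R (T x)) (Suc i) = coord x (Suc i)"
      by (simp add: coord_R coord_T mult.assoc[symmetric])
  qed
  define P where "P = (\<lambda>y. T (R y))"
  have norm_P: "norm (P y) \<le> norm y" for y by (simp add: P_def T norm_R)
  have range_T: "range T = V" using bij by (simp add: bij_betw_def)
  show ?thesis
  proof (rule one_complementedI[OF _ norm_P])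
    show "projection_onto P V"
      unfolding projection_onto_def
    proof (intro conjI)
      show "bounded_linear P"
        by (rule bounded_linear_intro[of _ 1])
          (simp_all add: norm_P, simp_all add: P_def R_add R_scale T(1,2))
      show "P \<circ> P = P" by (simp add: fun_eq_iff P_def RT)
      have "T x = P (T x)" for x by (simp add: P_def RT)
      then show "range P = V" unfolding range_T[symmetric] by (auto simp: P_def)
    qed
    show "T const_one \<in> V" using range_T by blast
    show "T const_one \<noteq> 0" using T(3)[of const_one] by auto
  qed
qed

section \<open>The hyperplane c0 and the value 2 of the projection constant\<close>

lemma c0_eq: "c0 = {x. coord x 0 = 0}"
proof -
  have *: "seq_of x \<longlonglongrightarrow> coord x 0" for x
    using LIMSEQ_Suc[OF coord_tendsto[of x]] by (simp add: seq_of_eq_coord[abs_def])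
  show ?thesis
    unfolding c0_def
  proof (intro Collect_cong iffI)
    show "coord x 0 = 0" if "seq_of x \<longlonglongrightarrow> 0" for x using LIMSEQ_unique[OF * that] .
    show "seq_of x \<longlonglongrightarrow> 0" if "coord x 0 = 0" for x using *[of x] that by simp
  qed
qed

lemma c0_subspace: "subspace c0"
  by (rule subspaceI) (auto simp: c0_eq)

lemma pairing_limit:
  fixes f :: "nat \<Rightarrow> real"
  assumes "\<And>j. j \<ge> 1 \<Longrightarrow> f j = 0"
  shows "pairing f x = f 0 * coord x 0"
proof -
  have "f = f 0 *\<^sub>R indicator {0}" using assms by (auto simp: fun_eq_iff indicator_def)
  then show ?thesis by (metis ell1_indicator pairing_indicator pairing_scaleR_left)
qed

lemma isometric_c0I:
  fixes f :: "nat \<Rightarrow> real"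
  assumes "\<bar>f 0\<bar> = 1" "\<And>j. j \<ge> 1 \<Longrightarrow> f j = 0"
  shows "isometric (W f) norm c0 norm"
proof -
  have "W f = c0" using assms(1) by (auto simp: W_def c0_eq pairing_limit[OF assms(2)])
  then show ?thesis
    by (intro isometricI[of _ "\<lambda>x. x"]) (simp_all add: c0_subspace)
qed

context
  fixes f :: "nat \<Rightarrow> real"
  assumes f: "f \<in> ell1" and f1: "ell1_norm f = 1"
begin

lemma abs_coeff_0_eq_1:
  assumes "\<And>j. j \<ge> 1 \<Longrightarrow> f j = 0"
  shows "\<bar>f 0\<bar> = 1"
proof -
  have "f(0 := 0) = (\<lambda>_. 0)" using assms by (auto simp: fun_eq_iff)
  then show ?thesis using ell1_norm_remove(2)[OF f, of 0] f1 by (simp add: ell1_norm_def)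
qed

lemma isometric_c0_imp:
  assumes iso: "isometric (W f) norm c0 norm"
  shows "\<bar>f 0\<bar> = 1 \<and> (\<forall>j\<ge>1. f j = 0)"
proof -
  obtain T where bij: "bij_betw T c0 (W f)"
    and T: "\<And>x y. x \<in> c0 \<Longrightarrow> y \<in> c0 \<Longrightarrow> T (x + y) = T x + T y"
      "\<And>r x. x \<in> c0 \<Longrightarrow> T (r *\<^sub>R x) = r *\<^sub>R T x" "\<And>x. x \<in> c0 \<Longrightarrow> norm (T x) = norm x"
    using isometric_sym[OF iso W_subspace[OF f]] unfolding isometric_def by auto
  have spike: "spike (Suc m) \<in> c0" for m by (simp add: c0_eq)
  obtain k s where k: "inj k" and s: "\<And>m. \<bar>s m\<bar> = 1"
    and coord_T: "\<And>m x. x \<in> c0 \<Longrightarrow> coord (T x) (k m) = s m * coord x (Suc m)"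
    using isometry_coords[OF c0_subspace spike T] by blast
  \<comment> \<open>No nonzero constant sequence lies in c0, so the signs are not known to converge;
    absolute values remove them.\<close>
  have W_0: "coord y 0 = 0" if "y \<in> W f" for y
  proof -
    have "y \<in> T ` c0" using that bij_betw_imp_surj_on[OF bij] by simp
    then obtain x where x: "x \<in> c0" "y = T x" by blast
    have "(\<lambda>m. \<bar>coord y (k m)\<bar>) \<longlonglongrightarrow> \<bar>coord y 0\<bar>"
      by (intro tendsto_rabs coord_inj_tendsto k)
    moreover have "(\<lambda>m. \<bar>coord y (k m)\<bar>) \<longlonglongrightarrow> \<bar>coord x 0\<bar>"
      using x by (simp add: coord_T abs_mult s tendsto_rabs LIMSEQ_Suc[OF coord_tendsto])
    ultimately have "\<bar>coord y 0\<bar> = \<bar>coord x 0\<bar>" by (rule LIMSEQ_unique)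
    then show ?thesis using x by (simp add: c0_eq)
  qed
  have "f j = 0" if j: "j \<ge> 1" for j
  proof (rule ccontr)
    assume fj: "f j \<noteq> 0"
    \<comment> \<open>A correction at the isolated point \<open>j\<close> puts the constant sequence
      into \<open>W f\<close> and leaves its limit equal to 1.\<close>
    define y where "y = const_one - (pairing f const_one / f j) *\<^sub>R spike j"
    have "y \<in> W f"
      using fj j by (simp add: W_def y_def linear_diff[OF pairing_linear[OF f]] pairing_scaleR[OF f])
    moreover have "coord y 0 = 1" using j by (simp add: y_def)
    ultimately show False using W_0 by force
  qed
  then show ?thesis using abs_coeff_0_eq_1 by blast
qed

text \<open>Here f(z) = 1 only says that |z_0| = 1. For k >= 1 the coordinate functional has norm 1
  + |z_k|, which tends to 2 whatever \<open>z\<close> is; a constant \<open>z\<close> of norm 1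
  shows that 2 suffices.\<close>

lemma projection_constant_eq_2:
  assumes f0: "\<bar>f 0\<bar> = 1" "\<And>j. j \<ge> 1 \<Longrightarrow> f j = 0"
  shows "projection_constant (W f) = 2"
proof (rule antisym)
  define z where "z = f 0 *\<^sub>R const_one"
  have z: "pairing f z = 1" "norm z = 1"
    using f0(1) by (auto simp: z_def pairing_limit[OF f0(2)] abs_if split: if_splits)
  note P = hyperplane_projection[OF f z(1)]
  have "onorm (\<lambda>x. x - pairing f x *\<^sub>R z) \<le> 2"
  proof (rule onorm_bound)
    show "norm (x - pairing f x *\<^sub>R z) \<le> 2 * norm x" for x
      using norm_triangle_ineq4[of x "pairing f x *\<^sub>R z"] abs_pairing_le[OF f, of x] f1
      by (simp add: z(2))
  qed simp
  with P show "projection_constant (W f) \<le> 2" by (rule projection_constant_le)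
  show "2 \<le> projection_constant (W f)"
    unfolding projection_constant_def
  proof (rule cInf_greatest)
    show "{onorm P |P. projection_onto P (W f)} \<noteq> {}" using P by blast
    fix r assume "r \<in> {onorm P |P. projection_onto P (W f)}"
    then obtain P where P: "r = onorm P" "projection_onto P (W f)" by blast
    obtain z where z: "pairing f z = 1" "\<And>x. P x = x - pairing f x *\<^sub>R z"
      using projection_onto_hyperplaneE[OF f f1 P(2)] by blast
    have "\<bar>f 0\<bar> * \<bar>coord z 0\<bar> = 1"
      using z(1) by (simp add: pairing_limit[OF f0(2)] abs_mult[symmetric])
    then have z0: "\<bar>coord z 0\<bar> = 1" using f0(1) by simp
    have le: "1 + \<bar>coord z (Suc k)\<bar> \<le> r" for k
      using onorm_hyperplane_projection_ge[OF f f1 _ z(2), of "Suc k"] P f0(2)[of "Suc k"]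
      by (auto simp: projection_onto_def)
    have "(\<lambda>k. 1 + \<bar>coord z (Suc k)\<bar>) \<longlonglongrightarrow> 1 + \<bar>coord z 0\<bar>"
      by (intro tendsto_add tendsto_const tendsto_rabs LIMSEQ_Suc coord_tendsto)
    then have "1 + \<bar>coord z 0\<bar> \<le> r"
      by (rule LIMSEQ_le_const2) (use le in auto)
    then show "2 \<le> r" using z0 by simp
  qed
qed

text \<open>The vector \<open>z\<close> follows the signs of \<open>f\<close>, damped by \<open>1 - d\<close> off the coordinate \<open>j\<close> so that
  \<open>1 + \<bar>z\<^sub>k\<bar> \<le> 2 - d\<close> there; the lost mass goes to \<open>j\<close>, and \<open>d = a\<^sup>2 / 2\<close> is small enough for the
  bound at \<open>j\<close>.\<close>

lemma projection_constant_less_2: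
  assumes j: "j \<ge> 1" and fj: "f j \<noteq> 0"
  shows "projection_constant (W f) < 2"
proof (cases "1 / 2 \<le> \<bar>f j\<bar>")
  case True
  obtain P where "projection_onto P (W f)" "onorm P = 1"
    using large_coeff_imp_one_complemented[OF f f1 j True] by (auto simp: one_complemented_def)
  then show ?thesis using projection_constant_le[of P "W f" 1] by simp
next
  case False
  define a where "a = \<bar>f j\<bar>"
  have a: "0 < a" "a < 1 / 2" using fj False by (auto simp: a_def)
  define d where "d = a\<^sup>2 / 2"
  have d: "0 < d" "d \<le> a" "d < 1"
    using a mult_strict_mono[of a 1 a 1] by (auto simp: d_def power2_eq_square)
  have r: "f(j := 0) \<in> ell1" "ell1_norm (f(j := 0)) = 1 - a"
    using ell1_norm_remove[OF f, of j] f1 by (auto simp: a_def)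
  obtain x where x: "norm x \<le> 1" "pairing (f(j := 0)) x \<ge> 1 - a - d"
    using pairing_almost_norming[OF r(1) d(1)] unfolding r(2) by blast
  \<comment> \<open>The contribution of the damped coordinates to \<open>pairing f z\<close>, close
    to the mass 1 - a outside \<open>j\<close>.\<close>
  define t where "t = (1 - d) * pairing (f(j := 0)) x"
  have "pairing (f(j := 0)) x \<le> (1 - a) * norm x"
    using abs_pairing_le[OF r(1), of x] by (simp add: r(2))
  also have "\<dots> \<le> 1 - a" using a x(1) by (simp add: mult_left_le)
  finally have "t \<le> (1 - d) * (1 - a)"
    unfolding t_def using d by (intro mult_left_mono) auto
  also have "\<dots> \<le> 1" using a d by (intro mult_le_one) auto
  finally have t1: "t \<le> 1" .
  \<comment> \<open>The product is at least 1 - a - 2 d, and 2 d is the square of a.\<close>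
  have "1 - a - a\<^sup>2 \<le> (1 - d) * (1 - a - d)"
  proof -
    have "(1 - d) * (1 - a - d) - (1 - a - 2 * d) = d * (a + d)"
      by (simp add: algebra_simps power2_eq_square)
    moreover have "0 \<le> d * (a + d)" using a d by simp
    ultimately show ?thesis by (simp add: d_def)
  qed
  also have "\<dots> \<le> t"
    unfolding t_def using d x by (intro mult_left_mono) auto
  finally have t: "1 - a - a\<^sup>2 \<le> t" .
  have "a\<^sup>2 < a" using a mult_strict_left_mono[of a 1 a] by (simp add: power2_eq_square)
  then have t0: "0 \<le> t" using t a by linarith
  \<comment> \<open>The coordinate at \<open>j\<close> supplies the missing 1 - t, so that f(z) =
    1.\<close>
  define c where "c = (1 - t) / f j"
  define z where "z = (1 - d) *\<^sub>R (x - coord x j *\<^sub>R spike j) + c *\<^sub>R spike j"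
  have z_j: "coord z j = c" using j by (simp add: z_def)
  have z_i: "\<bar>coord z i\<bar> \<le> 1 - d" if "i \<noteq> j" for i
  proof -
    have "\<bar>coord z i\<bar> = (1 - d) * \<bar>coord x i\<bar>"
      using that j d by (simp add: z_def abs_mult)
    also have "\<dots> \<le> (1 - d) * 1"
      using d x(1) abs_coord_le[of x i] by (intro mult_left_mono) auto
    finally show ?thesis by simp
  qed
  have "pairing (f(j := 0)) z = t"
    using j by (simp add: z_def t_def linear_diff[OF pairing_linear[OF r(1)]]
        pairing_add[OF r(1)] pairing_scaleR[OF r(1)])
  then have z: "pairing f z = 1"
    using pairing_remove[OF f, of z j] fj by (simp add: z_j c_def)
  have "\<bar>1 - c * f j\<bar> + \<bar>c\<bar> * (1 - \<bar>f j\<bar>) \<le> 2 - d"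
  proof -
    have "\<bar>1 - c * f j\<bar> = t" "\<bar>c\<bar> = (1 - t) / a"
      using fj t0 t1 by (auto simp: c_def a_def abs_div)
    \<comment> \<open>After multiplication by a, the claim is t (1 - 2 a) >= 1 - 3 a + a^2. The
      lower bound on t yields it with 2 a^3 to spare; 1 - 2 a is positive in this case.\<close>
    moreover have "t + (1 - t) / a * (1 - a) \<le> 2 - a"
    proof -
      have "(1 - a - a\<^sup>2) * (1 - 2 * a) \<le> t * (1 - 2 * a)"
        using t a by (intro mult_right_mono) auto
      moreover have "0 \<le> a ^ 3" using a by simp
      ultimately have "t * a + (1 - t) * (1 - a) \<le> (2 - a) * a"
        by (simp add: algebra_simps power2_eq_square power3_eq_cube)
      then show ?thesis using a by (simp add: field_simps)
    qed
    ultimately show ?thesis using d by (simp add: a_def)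
  qed
  then have e: "ell1_norm (indicator {j} - c *\<^sub>R f) \<le> 2 - d"
    by (simp add: ell1_norm_indicator_diff[OF f f1])
  have "onorm (\<lambda>y. y - pairing f y *\<^sub>R z) \<le> 2 - d"
  proof (rule onorm_bound)
    fix y
    have eq_j: "\<bar>coord (y - pairing f y *\<^sub>R z) j\<bar> \<le> (2 - d) * norm y"
    proof -
      have g: "indicator {j} - c *\<^sub>R f \<in> ell1" using f by blast
      have "coord (y - pairing f y *\<^sub>R z) j = pairing (indicator {j} - c *\<^sub>R f) y"
        using f by (simp add: pairing_diff_left pairing_scaleR_left ell1_scaleR ell1_indicator z_j)
      also have "\<bar>\<dots>\<bar> \<le> ell1_norm (indicator {j} - c *\<^sub>R f) * norm y"
        by (rule abs_pairing_le[OF g])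
      also have "\<dots> \<le> (2 - d) * norm y" by (intro mult_right_mono e) simp
      finally show ?thesis .
    qed
    have neq_j: "\<bar>coord (y - pairing f y *\<^sub>R z) i\<bar> \<le> (2 - d) * norm y" if "i \<noteq> j" for i
    proof -
      have "\<bar>pairing f y * coord z i\<bar> \<le> norm y * (1 - d)"
        unfolding abs_mult using abs_pairing_le[OF f, of y] f1 z_i[OF that]
        by (intro mult_mono) auto
      then show ?thesis
        using abs_coord_le[of y i] abs_triangle_ineq4[of "coord y i" "pairing f y * coord z i"]
        by (simp add: algebra_simps)
    qed
    show "norm (y - pairing f y *\<^sub>R z) \<le> (2 - d) * norm y"
    proof (rule norm_convseq_le)
      show "\<bar>coord (y - pairing f y *\<^sub>R z) (Suc i)\<bar> \<le> (2 - d) * norm y" for i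
        using eq_j neq_j[of "Suc i"] by (cases "Suc i = j") blast+
    qed
  qed (use d in simp)
  then have "projection_constant (W f) \<le> 2 - d"
    by (rule projection_constant_le[OF hyperplane_projection[OF f z]])
  then show ?thesis using d by simp
qed

end

section \<open>The dual as a quotient of l1\<close>

lemma ell1_norm_insert_zero:
  assumes g: "g \<in> ell1"
  shows "insert_zero j g \<in> ell1" "ell1_norm (insert_zero j g) = ell1_norm g"
proof -
  have "(\<lambda>i. \<bar>g i\<bar>) sums ell1_norm g"
    using g by (simp add: ell1_iff ell1_norm_def summable_sums)
  then have "(\<lambda>i. \<bar>g (i + j)\<bar>) sums (ell1_norm g - (\<Sum>i<j. \<bar>g i\<bar>))"
    by (subst sums_iff_shift) simp
  moreover have "\<bar>g (i + j)\<bar> = \<bar>insert_zero j g (i + Suc j)\<bar>" for i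
    by (simp add: insert_zero_def)
  ultimately have "(\<lambda>i. \<bar>insert_zero j g (i + Suc j)\<bar>) sums (ell1_norm g - (\<Sum>i<j. \<bar>g i\<bar>))"
    by simp
  moreover have "(\<Sum>i<Suc j. \<bar>insert_zero j g i\<bar>) = (\<Sum>i<j. \<bar>g i\<bar>)"
    by (simp add: insert_zero_def)
  ultimately have "(\<lambda>i. \<bar>insert_zero j g i\<bar>) sums ell1_norm g"
    by (subst (asm) sums_iff_shift) simp
  then show "insert_zero j g \<in> ell1" "ell1_norm (insert_zero j g) = ell1_norm g"
    by (auto simp: ell1_iff ell1_norm_def sums_iff)
qed

lemma insert_zero_of_skip:
  assumes h: "h \<in> ell1" "h j = 0"
  obtains g where "g \<in> ell1" "h = insert_zero j g"
proof
  let ?g = "\<lambda>i. h (skip j i)"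
  show "h = insert_zero j ?g"
    using h(2) by (auto simp: fun_eq_iff insert_zero_def skip_def)
  have "summable (\<lambda>i. \<bar>h (i + Suc j)\<bar>)"
    using h(1) unfolding ell1_iff by (subst summable_iff_shift)
  then have "summable (\<lambda>i. \<bar>?g (i + j)\<bar>)" by (simp add: skip_def)
  then show "?g \<in> ell1" unfolding ell1_iff by (subst (asm) summable_iff_shift)
qed

text \<open>Finitely supported sequences are dense in l1, so a contraction is determined by its
  matrix, whose columns are the images of the unit vectors.\<close>

lemma ell1_operator_coord:
  assumes add: "\<And>g h. g \<in> ell1 \<Longrightarrow> h \<in> ell1 \<Longrightarrow> A (g + h) = A g + A h"
    and scale: "\<And>r g. g \<in> ell1 \<Longrightarrow> A (r *\<^sub>R g) = r *\<^sub>R A g"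
    and ell1: "\<And>g. g \<in> ell1 \<Longrightarrow> A g \<in> ell1"
    and norm: "\<And>g. g \<in> ell1 \<Longrightarrow> ell1_norm (A g) \<le> ell1_norm g"
    and h: "h \<in> ell1"
  shows "(\<lambda>i. h i * A (indicator {i}) n) sums A h n"
proof -
  \<comment> \<open>The tails of \<open>h\<close>. Passing to the next one removes a single entry,
    which allows an induction with finite additivity only; the contraction property then disposes of
    the limit.\<close>
  define r where "r = (\<lambda>N i. if i < N then 0 else h i :: real)"
  have r: "r N \<in> ell1" "ell1_norm (r N) = ell1_norm h - (\<Sum>i<N. \<bar>h i\<bar>)"
      "A (r N) n = A h n - (\<Sum>i<N. h i * A (indicator {i}) n)" for N
  proof (induction N)
    case 0
    have "r 0 = h" by (simp add: r_def)
    then show "r 0 \<in> ell1" "ell1_norm (r 0) = ell1_norm h - (\<Sum>i<0. \<bar>h i\<bar>)"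
      "A (r 0) n = A h n - (\<Sum>i<0. h i * A (indicator {i}) n)"
      using h by auto
  next
    case (Suc N)
    have eq: "r (Suc N) = (r N)(N := 0)" "r (Suc N) = r N + (- h N) *\<^sub>R indicator {N}"
      by (auto simp: r_def fun_eq_iff indicator_def less_Suc_eq)
    have rN: "r N N = h N" by (simp add: r_def)
    show "r (Suc N) \<in> ell1" "ell1_norm (r (Suc N)) = ell1_norm h - (\<Sum>i<Suc N. \<bar>h i\<bar>)"
      using ell1_norm_remove[OF Suc(1), of N] Suc(2) rN unfolding eq(1) by auto
    show "A (r (Suc N)) n = A h n - (\<Sum>i<Suc N. h i * A (indicator {i}) n)"
      unfolding eq(2) using Suc(3)
      by (simp add: add[OF Suc(1) ell1_scaleR[OF ell1_indicator]] scale[OF ell1_indicator]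
          del: scaleR_minus_left)
  qed
  have "(\<lambda>N. ell1_norm h - (\<Sum>i<N. \<bar>h i\<bar>)) \<longlonglongrightarrow> ell1_norm h - ell1_norm h"
    using h by (intro tendsto_diff tendsto_const)
      (simp add: ell1_iff ell1_norm_def summable_LIMSEQ)
  then have lim: "(\<lambda>N. ell1_norm (r N)) \<longlonglongrightarrow> 0" by (simp add: r)
  have "(\<lambda>N. A (r N) n) \<longlonglongrightarrow> 0"
  proof (rule Lim_null_comparison[OF _ lim])
    show "eventually (\<lambda>N. norm (A (r N) n) \<le> ell1_norm (r N)) sequentially"
      using abs_le_ell1_norm[OF ell1[OF r(1)]] norm[OF r(1)]
      by (intro always_eventually allI) (auto intro: order_trans)
  qed
  then have "(\<lambda>N. A h n - A (r N) n) \<longlonglongrightarrow> A h n - 0"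
    by (intro tendsto_diff tendsto_const)
  then show ?thesis by (simp add: sums_def r)
qed

text \<open>Builds a preimage of \<open>a\<close> for a map that sends the unit vector at
  \<open>i m\<close> to \<open>s m\<close> times the one at \<open>m\<close>: supported on
  \<open>range i\<close> and of no larger norm.\<close>

lemma ell1_reindex:
  fixes i :: "nat \<Rightarrow> nat" and s :: "nat \<Rightarrow> real"
  assumes i: "inj i" and s: "\<And>m. \<bar>s m\<bar> = 1" and a: "a \<in> ell1"
  obtains g where "g \<in> ell1" "ell1_norm g \<le> ell1_norm a"
    "\<And>m. g (i m) = s m * a m" "\<And>k. k \<notin> range i \<Longrightarrow> g k = 0"
proof -
  define g where "g = (\<lambda>k. if k \<in> range i then s (inv i k) * a (inv i k) else 0)"
  have le: "(\<Sum>k<N. \<bar>g k\<bar>) \<le> ell1_norm a" for N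
  proof -
    let ?F = "{..<N} \<inter> range i"
    have "(\<Sum>k<N. \<bar>g k\<bar>) = (\<Sum>k\<in>?F. \<bar>a (inv i k)\<bar>)"
      by (rule sum.mono_neutral_cong_right) (auto simp: g_def abs_mult s)
    also have "\<dots> = (\<Sum>m\<in>inv i ` ?F. \<bar>a m\<bar>)"
      by (subst sum.reindex) (auto intro: inj_on_subset[OF inj_on_inv_into[of "range i" i UNIV]])
    also have "\<dots> \<le> ell1_norm a"
      unfolding ell1_norm_def using a by (intro sum_le_suminf) (auto simp: ell1_iff)
    finally show ?thesis .
  qed
  then have g: "summable (\<lambda>k. \<bar>g k\<bar>)"
    by (intro summableI_nonneg_bounded) auto
  show thesis
  proof (rule that)
    show "g \<in> ell1" using g by (simp add: ell1_iff)
    show "ell1_norm g \<le> ell1_norm a"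
      unfolding ell1_norm_def[of g] by (rule suminf_le_const[OF g le])
    show "g (i m) = s m * a m" for m using i by (simp add: g_def)
    show "g k = 0" if "k \<notin> range i" for k using that by (simp add: g_def)
  qed
qed

text \<open>A lift of an extreme point of the ball of \<open>\<ell>\<^sub>1\<close> forces some unit vector to be mapped to it
  up to sign. If the unit vectors so obtained miss an index \<open>j\<close>, then \<open>1 = t f\<^sub>j\<close> for a kernel
  element \<open>t f\<close> of norm at most 2; if they exhaust all indices, then \<open>A\<close> is injective.\<close>

lemma ell1_quotient_large_coeff:
  assumes f: "f \<in> ell1" and f1: "ell1_norm f = 1"
    and add: "\<And>g h. g \<in> ell1 \<Longrightarrow> h \<in> ell1 \<Longrightarrow> A (g + h) = A g + A h"
    and scale: "\<And>r g. g \<in> ell1 \<Longrightarrow> A (r *\<^sub>R g) = r *\<^sub>R A g"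
    and ell1: "\<And>g. g \<in> ell1 \<Longrightarrow> A g \<in> ell1"
    and norm: "\<And>g. g \<in> ell1 \<Longrightarrow> ell1_norm (A g) \<le> ell1_norm g"
    and kernel: "\<And>g. g \<in> ell1 \<Longrightarrow> A g = 0 \<Longrightarrow> \<exists>t. g = t *\<^sub>R f" and Af: "A f = 0"
    and lift: "\<And>a. a \<in> ell1 \<Longrightarrow> \<exists>h\<in>ell1. ell1_norm h \<le> ell1_norm a \<and> A h = a"
  shows "\<exists>j. 1 / 2 \<le> \<bar>f j\<bar>"
proof -
  define b where "b = (\<lambda>i. A (indicator {i}))"
  have b: "b i \<in> ell1" "ell1_norm (b i) \<le> 1" for i
    using ell1[OF ell1_indicator] norm[OF ell1_indicator] by (auto simp: b_def)
  have A_coord: "(\<lambda>i. h i * b i n) sums A h n" if "h \<in> ell1" for h n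
    unfolding b_def by (rule ell1_operator_coord[OF add scale ell1 norm that])
  have "\<exists>i s. \<bar>s\<bar> = 1 \<and> b i = s *\<^sub>R indicator {m}" for m
  proof -
    obtain h where h: "h \<in> ell1" "ell1_norm h \<le> 1" "A h = indicator {m}"
      using lift[OF ell1_indicator, of m] by auto
    have s1: "(\<lambda>i. h i * b i m) sums 1" using A_coord[OF h(1), of m] h(3) by simp
    have bm: "\<bar>b i m\<bar> \<le> 1" for i using abs_le_ell1_norm[OF b(1), of i m] b(2)[of i] by simp
    \<comment> \<open>Nonnegative defects whose sum is at most 0, so each vanishes: wherever
      \<open>h\<close> is nonzero, the column \<open>b i\<close> has modulus 1 at
      \<open>m\<close>.\<close>
    let ?d = "\<lambda>i. \<bar>h i\<bar> - h i * b i m"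
    have "?d sums (ell1_norm h - 1)"
      using h(1) s1 by (intro sums_diff) (simp_all add: ell1_iff ell1_norm_def summable_sums)
    moreover have d0: "0 \<le> ?d i" for i
    proof -
      have "h i * b i m \<le> \<bar>h i\<bar> * \<bar>b i m\<bar>" by (metis abs_ge_self abs_mult)
      also have "\<dots> \<le> \<bar>h i\<bar>" using bm by (simp add: mult_left_le)
      finally show ?thesis by simp
    qed
    ultimately have "suminf ?d = 0" "summable ?d"
      using h(2) suminf_nonneg[of ?d] by (auto simp: sums_iff)
    then have d: "?d i = 0" for i
      using d0 suminf_eq_zero_iff[of ?d] by auto
    obtain i where i: "h i \<noteq> 0"
      using s1 sums_unique2[of "\<lambda>_. 0 :: real" 0 1] by force
    have "\<bar>h i\<bar> = h i * b i m" using d[of i] by simp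
    then have "\<bar>h i\<bar> = \<bar>h i\<bar> * \<bar>b i m\<bar>" by (metis abs_abs abs_mult)
    then have one: "\<bar>b i m\<bar> = 1" using i by simp
    \<comment> \<open>The entry at \<open>m\<close> already exhausts the norm of the column.\<close>
    have "(b i)(m := 0) = 0"
      by (rule ell1_norm_eq_0) (use ell1_norm_remove[OF b(1), of i m] b(2)[of i] one in auto)
    then have "b i = b i m *\<^sub>R indicator {m}"
      by (auto simp: fun_eq_iff indicator_def split: if_splits)
    with one show ?thesis by blast
  qed
  then obtain i s where s: "\<And>m. \<bar>s m\<bar> = 1" and b_i: "\<And>m. b (i m) = s m *\<^sub>R indicator {m}"
    by metis
  have "inj i"
  proof (rule injI, rule ccontr)
    fix m m' assume "i m = i m'" "m \<noteq> m'"
    then have "s m *\<^sub>R (indicator {m} :: nat \<Rightarrow> real) = s m' *\<^sub>R indicator {m'}"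
      using b_i[of m] b_i[of m'] by simp
    from fun_cong[OF this, of m] show False using \<open>m \<noteq> m'\<close> s[of m] by simp
  qed
  \<comment> \<open>On sequences supported on \<open>range i\<close> the map is a signed
    relabelling.\<close>
  have coord_range: "A g n = g (i n) * s n" if g: "g \<in> ell1" "\<And>k. k \<notin> range i \<Longrightarrow> g k = 0" for g n
  proof -
    have vanish: "g k * b k n = 0" if "k \<notin> {i n}" for k
    proof (cases "k \<in> range i")
      case True
      then obtain m where m: "k = i m" by blast
      then have "n \<noteq> m" using that by blast
      then show ?thesis unfolding m b_i by simp
    next
      case False
      show ?thesis unfolding g(2)[OF False] by simp
    qed
    have "(\<lambda>k. g k * b k n) sums (\<Sum>k\<in>{i n}. g k * b k n)"
      by (rule sums_finite[OF _ vanish]) simp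
    then have "A g n = (\<Sum>k\<in>{i n}. g k * b k n)"
      by (rule sums_unique2[OF A_coord[OF g(1), of n]])
    also have "\<dots> = g (i n) * b (i n) n" by simp
    also have "\<dots> = g (i n) * s n" unfolding b_i by simp
    finally show ?thesis .
  qed
  show ?thesis
  proof (cases "range i = UNIV")
    case True
    \<comment> \<open>A signed relabelling of all indices cannot annihilate the nonzero
      \<open>f\<close>.\<close>
    have "A f n = f (i n) * s n" for n
      by (rule coord_range[OF f]) (simp add: True)
    then have "f (i n) * s n = 0" for n by (simp add: Af)
    moreover have "s n \<noteq> 0" for n using s[of n] by auto
    ultimately have zero: "f (i n) = 0" for n by simp
    have "f k = 0" for k
    proof -
      have "k \<in> range i" using True by simp
      then show ?thesis using zero by blast
    qed
    then have "f = 0" by (simp add: fun_eq_iff)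
    then show ?thesis using f1 by (simp add: ell1_norm_def)
  next
    case False
    then obtain j where j: "j \<notin> range i" by blast
    obtain g where g: "g \<in> ell1" "ell1_norm g \<le> ell1_norm (b j)"
        "\<And>m. g (i m) = s m * b j m" "\<And>k. k \<notin> range i \<Longrightarrow> g k = 0"
      using ell1_reindex[of i s "b j", OF \<open>inj i\<close> s b(1)] by blast
    \<comment> \<open>\<open>g\<close> has the same image as the unit vector at \<open>j\<close> but
      vanishes at \<open>j\<close>, so the difference is a kernel element with entry 1
      there.\<close>
    have "A g = b j"
    proof
      fix n
      have "s n * s n = 1" using s[of n] by (metis abs_mult_self_eq mult_1)
      moreover have "A g n = g (i n) * s n"
        by (rule coord_range[OF g(1)]) (rule g(4))
      then have "A g n = (s n * s n) * b j n" by (simp add: g(3))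
      ultimately show "A g n = b j n" by simp
    qed
    let ?e = "indicator {j} + (-1) *\<^sub>R g"
    have g': "(-1) *\<^sub>R g \<in> ell1" by (rule ell1_scaleR[OF g(1)])
    have e: "?e \<in> ell1" by (rule ell1_add[OF ell1_indicator g'])
    have "A ?e = A (indicator {j}) + A ((-1) *\<^sub>R g)"
      by (rule add[OF ell1_indicator g'])
    also have "\<dots> = 0" using \<open>A g = b j\<close> scale[OF g(1), of "-1"] by (simp add: b_def)
    finally obtain t where t: "?e = t *\<^sub>R f" using kernel[OF e] by blast
    have "t * f j = 1" using fun_cong[OF t, of j] g(4)[OF j] by simp
    then have "\<bar>t\<bar> * \<bar>f j\<bar> = 1" unfolding abs_mult[symmetric] by simp
    moreover have "\<bar>t\<bar> \<le> 2"
    proof -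
      have "\<bar>t\<bar> = ell1_norm ?e" unfolding t using f1 ell1_norm_scaleR[OF f] by simp
      also have "\<dots> \<le> ell1_norm (indicator {j}) + ell1_norm ((-1) *\<^sub>R g)"
        by (rule ell1_norm_triangle[OF ell1_indicator g'])
      also have "\<dots> \<le> 2" using g(2) b(2)[of j] ell1_norm_scaleR[OF g(1), of "-1"] by simp
      finally show ?thesis .
    qed
    then have "\<bar>t\<bar> * \<bar>f j\<bar> \<le> 2 * \<bar>f j\<bar>" by (rule mult_right_mono) simp
    ultimately show ?thesis by (intro exI[of _ j]) linarith
  qed
qed

context
  fixes f :: "nat \<Rightarrow> real"
  assumes f: "f \<in> ell1" and f1: "ell1_norm f = 1"
begin

text \<open>The map studied on l1 is the given isometry after the quotient map; its norm-preserving
  lifts come from \<open>dual_lift\<close>.\<close>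

lemma isometric_dual_imp_large_coeff:
  assumes iso: "isometric (dual (W f)) (dual_norm (W f)) ell1 ell1_norm"
  shows "\<exists>j. 1 / 2 \<le> \<bar>f j\<bar>"
proof -
  let ?D = "dual (W f)"
  obtain T where bij: "bij_betw T ?D ell1"
    and T: "\<And>x y. x \<in> ?D \<Longrightarrow> y \<in> ?D \<Longrightarrow> T (x + y) = T x + T y"
      "\<And>r x. x \<in> ?D \<Longrightarrow> T (r *\<^sub>R x) = r *\<^sub>R T x"
      "\<And>x. x \<in> ?D \<Longrightarrow> ell1_norm (T x) = dual_norm (W f) x"
    using iso unfolding isometric_def by blast
  note D = restriction_dual[OF f]
  have zero: "restriction f 0 = 0"
    using restriction_scaleR[OF f, of f 0] by simp
  have zero_D: "0 \<in> ?D" using D[OF subspace_0[OF ell1_subspace]] unfolding zero .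
  have T0: "T 0 = 0" using T(2)[OF zero_D, of 0] by simp
  show ?thesis
  proof (rule ell1_quotient_large_coeff[OF f f1, of "\<lambda>g. T (restriction f g)"])
    show "T (restriction f (g + h)) = T (restriction f g) + T (restriction f h)"
      if "g \<in> ell1" "h \<in> ell1" for g h
      using that by (simp add: restriction_add T(1) D)
    show "T (restriction f (r *\<^sub>R g)) = r *\<^sub>R T (restriction f g)" if "g \<in> ell1" for r g
      using that by (simp add: restriction_scaleR T(2) D)
    show "T (restriction f g) \<in> ell1" if "g \<in> ell1" for g
      using bij_betwE[OF bij] D[OF that] by blast
    show "ell1_norm (T (restriction f g)) \<le> ell1_norm g" if "g \<in> ell1" for g
      using that by (simp add: T(3) D dual_norm_restriction_le[OF f])
    show "\<exists>t. g = t *\<^sub>R f" if g: "g \<in> ell1" "T (restriction f g) = 0" for g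
    proof -
      have "restriction f g = 0"
        by (rule inj_onD[OF bij_betw_imp_inj_on[OF bij] _ D[OF g(1)] zero_D]) (simp add: g(2) T0)
      then show ?thesis using restriction_eq_0_imp[OF f f1 g(1)] by blast
    qed
    have "restriction f f = 0" by (auto simp: fun_eq_iff restriction_def W_def)
    then show "T (restriction f f) = 0" by (simp add: T0)
    show "\<exists>h\<in>ell1. ell1_norm h \<le> ell1_norm a \<and> T (restriction f h) = a" if "a \<in> ell1" for a
    proof -
      have "a \<in> T ` ?D" using that bij_betw_imp_surj_on[OF bij] by simp
      then obtain \<phi> where \<phi>: "\<phi> \<in> ?D" "T \<phi> = a" by blast
      obtain h where "h \<in> ell1" "ell1_norm h \<le> dual_norm (W f) \<phi>" "\<phi> = restriction f h"
        using dual_lift[OF f f1 \<phi>(1)] .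
      with \<phi> T(3)[OF \<phi>(1)] show ?thesis by auto
    qed
  qed
qed

text \<open>Adding t f creates mass |t| |f j| at \<open>j\<close> and can cancel at most |t| (1 - |f
  j|) elsewhere. A representative vanishing at \<open>j\<close> is therefore the shortest in its
  coset.\<close>

lemma ell1_norm_le_add_scaleR:
  assumes g: "g \<in> ell1" "g j = 0" and j: "1 / 2 \<le> \<bar>f j\<bar>"
  shows "ell1_norm g \<le> ell1_norm (g + t *\<^sub>R f)"
proof -
  let ?r = "f(j := 0)" and ?h = "g + t *\<^sub>R f"
  have r: "?r \<in> ell1" "ell1_norm ?r = 1 - \<bar>f j\<bar>"
    using ell1_norm_remove[OF f, of j] f1 by auto
  have h: "?h \<in> ell1" using f g(1) by blast
  have eq: "?h(j := 0) + (- t) *\<^sub>R ?r = g" using g(2) by (auto simp: fun_eq_iff)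
  have "ell1_norm g \<le> ell1_norm (?h(j := 0)) + ell1_norm ((- t) *\<^sub>R ?r)"
    using ell1_norm_triangle[OF ell1_norm_remove(1)[OF h] ell1_scaleR[OF r(1)], of j "- t"]
    unfolding eq .
  also have "\<dots> = ell1_norm ?h - \<bar>t\<bar> * \<bar>f j\<bar> + \<bar>t\<bar> * (1 - \<bar>f j\<bar>)"
    using ell1_norm_remove(2)[OF h, of j] ell1_norm_scaleR[OF r(1), of "- t"] g(2)
    by (simp add: r(2) abs_mult)
  also have "\<dots> \<le> ell1_norm ?h"
  proof -
    have "\<bar>t\<bar> * (1 - \<bar>f j\<bar>) \<le> \<bar>t\<bar> * \<bar>f j\<bar>" using j by (intro mult_left_mono) auto
    then show ?thesis by simp
  qed
  finally show ?thesis .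
qed

text \<open>Every coset of the line of \<open>f\<close> contains an element that vanishes at
  \<open>j\<close>, and it realizes the quotient norm. Deleting the entry \<open>j\<close>
  identifies these elements with l1; j = 0 is allowed, as no continuity is involved.\<close>

lemma large_coeff_imp_isometric_dual:
  assumes j: "1 / 2 \<le> \<bar>f j\<bar>"
  shows "isometric (dual (W f)) (dual_norm (W f)) ell1 ell1_norm"
proof (rule isometric_sym[OF isometricI[OF ell1_subspace] ell1_subspace])
  let ?T = "\<lambda>g. restriction f (insert_zero j g)"
  show "?T (g + h) = ?T g + ?T h" if "g \<in> ell1" "h \<in> ell1" for g h
  proof -
    have "insert_zero j (g + h) = insert_zero j g + insert_zero j h"
      by (auto simp: fun_eq_iff insert_zero_def)
    then show ?thesis using that by (simp add: restriction_add ell1_norm_insert_zero(1))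
  qed
  show "?T (r *\<^sub>R g) = r *\<^sub>R ?T g" if "g \<in> ell1" for r g
  proof -
    have "insert_zero j (r *\<^sub>R g) = r *\<^sub>R insert_zero j g"
      by (auto simp: fun_eq_iff insert_zero_def)
    then show ?thesis using that by (simp add: restriction_scaleR ell1_norm_insert_zero(1))
  qed
  show "dual_norm (W f) (?T g) = ell1_norm g" if "g \<in> ell1" for g
  proof (rule antisym)
    note g = ell1_norm_insert_zero[OF that, of j]
    show "dual_norm (W f) (?T g) \<le> ell1_norm g"
      using dual_norm_restriction_le[OF f g(1)] by (simp add: g(2))
    \<comment> \<open>A second representative, of norm at most that of the functional; it differs
      from \<open>insert_zero j g\<close> by a multiple of \<open>f\<close> and so cannot be
      shorter.\<close>
    obtain h where h: "h \<in> ell1" "ell1_norm h \<le> dual_norm (W f) (?T g)" "?T g = restriction f h"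
      using dual_lift[OF f f1 restriction_dual[OF f g(1)]] .
    have d: "h + (-1) *\<^sub>R insert_zero j g \<in> ell1"
      by (rule ell1_add[OF h(1) ell1_scaleR[OF g(1)]])
    have "restriction f (h + (-1) *\<^sub>R insert_zero j g) = 0"
      using restriction_add[OF h(1) ell1_scaleR[OF g(1)], of f "-1"]
        restriction_scaleR[OF g(1), of f "-1"] h(3) by simp
    then obtain t where "h + (-1) *\<^sub>R insert_zero j g = t *\<^sub>R f"
      using restriction_eq_0_imp[OF f f1 d] by blast
    then have "h = insert_zero j g + t *\<^sub>R f" by (simp add: algebra_simps)
    then show "ell1_norm g \<le> dual_norm (W f) (?T g)"
      using ell1_norm_le_add_scaleR[OF g(1) _ j, of t] h(2) g(2) by simp
  qed
  show "ell1_norm g = 0 \<longleftrightarrow> g = 0" if "g \<in> ell1" for g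
    using that by (rule ell1_norm_eq_0_iff)
  have "\<phi> \<in> ?T ` ell1" if \<phi>: "\<phi> \<in> dual (W f)" for \<phi>
  proof -
    obtain h where h: "h \<in> ell1" "\<phi> = restriction f h"
      using dual_lift[OF f f1 \<phi>] by blast
    \<comment> \<open>The same functional, with the entry at \<open>j\<close> cleared by a multiple
      of \<open>f\<close>.\<close>
    define h' where "h' = h + (- h j / f j) *\<^sub>R f"
    have h': "h' \<in> ell1" "h' j = 0"
      using j by (auto simp: h'_def simp del: scaleR_minus_left intro!: ell1_add ell1_scaleR h(1) f)
    have "restriction f f = 0" by (auto simp: fun_eq_iff restriction_def W_def)
    then have "\<phi> = restriction f h'"
      using h f by (simp add: h'_def restriction_add restriction_scaleR ell1_scaleR
          del: scaleR_minus_left)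
    moreover obtain g where "g \<in> ell1" "h' = insert_zero j g"
      using insert_zero_of_skip[OF h'] .
    ultimately show ?thesis by blast
  qed
  then show "?T ` ell1 = dual (W f)"
    using restriction_dual[OF f] ell1_norm_insert_zero(1) by blast
qed

end

theorem theorem1p2:
  fixes f :: "nat \<Rightarrow> real"
  assumes "f \<in> ell1" and "ell1_norm f = 1"
  shows
    "(one_complemented (W f) \<longleftrightarrow> isometric (W f) norm (UNIV :: convseq set) norm) \<and>
     (isometric (W f) norm (UNIV :: convseq set) norm \<longleftrightarrow> (\<exists>j\<ge>1. \<bar>f j\<bar> \<ge> 1/2)) \<and>
     ((\<exists>j\<ge>1. \<bar>f j\<bar> \<ge> 1/2) \<longrightarrow> isometric (dual (W f)) (dual_norm (W f)) ell1 ell1_norm) \<and>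
     (isometric (dual (W f)) (dual_norm (W f)) ell1 ell1_norm \<longleftrightarrow> (\<exists>j. \<bar>f j\<bar> \<ge> 1/2)) \<and>
     (isometric (W f) norm c0 norm \<longrightarrow> (\<exists>j. \<bar>f j\<bar> \<ge> 1/2)) \<and>
     (isometric (W f) norm c0 norm \<longleftrightarrow> projection_constant (W f) = 2) \<and>
     (projection_constant (W f) = 2 \<longleftrightarrow> \<bar>f 0\<bar> = 1 \<and> (\<forall>j\<ge>1. f j = 0))"
proof -
  note f = assms
  \<comment> \<open>Every property is translated into a condition on the coefficients, where the
    remaining implications are immediate.\<close>
  have 1: "one_complemented (W f) \<longleftrightarrow> (\<exists>j\<ge>1. \<bar>f j\<bar> \<ge> 1/2)"
    using one_complemented_imp_large_coeff[OF f] large_coeff_imp_one_complemented[OF f] by blast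
  have 2: "isometric (W f) norm (UNIV :: convseq set) norm \<longleftrightarrow> (\<exists>j\<ge>1. \<bar>f j\<bar> \<ge> 1/2)"
    using isometric_c_imp_one_complemented[OF W_subspace[OF f(1)]]
      large_coeff_imp_isometric_c[OF f] 1 by blast
  have 4: "isometric (dual (W f)) (dual_norm (W f)) ell1 ell1_norm \<longleftrightarrow> (\<exists>j. \<bar>f j\<bar> \<ge> 1/2)"
    using isometric_dual_imp_large_coeff[OF f] large_coeff_imp_isometric_dual[OF f] by blast
  have 6: "isometric (W f) norm c0 norm \<longleftrightarrow> \<bar>f 0\<bar> = 1 \<and> (\<forall>j\<ge>1. f j = 0)"
    using isometric_c0_imp[OF f] isometric_c0I by blast
  have 7: "projection_constant (W f) = 2 \<longleftrightarrow> \<bar>f 0\<bar> = 1 \<and> (\<forall>j\<ge>1. f j = 0)"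
  proof
    assume "projection_constant (W f) = 2"
    then have "f j = 0" if "j \<ge> 1" for j
      using projection_constant_less_2[OF f that] by force
    then show "\<bar>f 0\<bar> = 1 \<and> (\<forall>j\<ge>1. f j = 0)"
      using abs_coeff_0_eq_1[OF f] by blast
  qed (use projection_constant_eq_2[OF f] in blast)
  have 5: "\<bar>f 0\<bar> = 1 \<Longrightarrow> \<exists>j. \<bar>f j\<bar> \<ge> 1/2"
    by (rule exI[of _ 0]) simp
  show ?thesis
    unfolding 1 2 4 6 7 using 5 by blast
qed

end
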